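(* Let $X_1,\dots,X_n$ be independent random variables, $X=(X_1,\dots,X_n)$, and assume that $f=f(X)\in L^2(\mathbb{P})$ admits a Hoeffding decomposition of the form $f=\mathbb{E}f+\sum_{k=d}^n f_k$ for some $1\le d\le n$. Then $$\mathrm{Var} f\le\frac1{d!}\,\mathbb{E}|\mathfrak{v}^{(d)}f|^2,\qquad \mathrm{Var} f\le\frac1{d!}\,\mathbb{E}|\mathfrak{D}^{(d)}f|^2,\qquad \mathrm{Var} f\le\frac1{d!}\,\mathbb{E}|\mathfrak{d}^{(d)}f|^2.$$ Moreover, $$\mathrm{Var} f\le\frac2{d!}\,\mathbb{E}|\mathfrak{d}^{+(d)}f|^2\qquad\text{and}\qquad \mathrm{Var} f\le\frac2{d!}\,\mathbb{E}|\mathfrak{d}^{-(d)}f|^2.$$ Equality holds (in each of these inequalities) if and only if the Hoeffding decomposition of $f$ consists of the expected value and the $d$-th order term only, i.e. $f=\mathbb{E}f+f_d$.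
   Context: Hoeffding decomposition: for $f(X)\in L^1(\mathbb{P})$ it is the unique decomposition $f(X)=\sum_{k=0}^n f_k$, $f_0=\mathbb{E}f(X)$, $f_k=\sum_{1\le i_1<\dots<i_k\le n}h_{i_1\dots i_k}(X_{i_1},\dots,X_{i_k})$, such that $\mathbb{E}_{i_s}h_{i_1\dots i_k}(X_{i_1},\dots,X_{i_k})=0$ for all $i_1<\dots<i_k$ and $s=1,\dots,k$. Here $\mathbb{E}_i$ is expectation with respect to $X_i$ only, and $\mathbb{E}_{i_1\dots i_d}$ with respect to $X_{i_1},\dots,X_{i_d}$. Let $\bar X_1,\dots,\bar X_n$ be an independent copy of $X$, $T_if=f(X_1,\dots,X_{i-1},\bar X_i,X_{i+1},\dots,X_n)$, and let $\bar{\mathbb{E}}_{i_1\dots i_d}$ be expectation with respect to $\bar X_{i_1},\dots,\bar X_{i_d}$. Write $x_+=\max(x,0)$, $x_-=\max(-x,0)$. For pairwise distinct indices define $$\mathfrak{D}_{i_1\dots i_d}f=\prod_{s=1}^d(Id-\mathbb{E}_{i_s})f,\qquad \mathfrak{v}_{i_1\dots i_d}f=\Big(\mathbb{E}_{i_1\dots i_d}\Big(\prod_{s=1}^d(Id-\mathbb{E}_{i_s})f\Big)^2\Big)^{1/2},$$ $$\mathfrak{d}_{i_1\dots i_d}f=\Big(\frac1{2^d}\bar{\mathbb{E}}_{i_1\dots i_d}\Big(\prod_{s=1}^d(Id-T_{i_s})f\Big)^2\Big)^{1/2},\qquad \mathfrak{d}^{\pm}_{i_1\dots i_d}f=\Big(\frac1{2^d}\bar{\mathbb{E}}_{i_1\dots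 i_d}\Big(\prod_{s=1}^d(Id-T_{i_s})f\Big)_\pm^2\Big)^{1/2}.$$ For each of these, e.g. $\mathfrak{v}$, the hypermatrix $\mathfrak{v}^{(d)}f$ has entries $\mathfrak{v}_{i_1\dots i_d}f$ if $i_1,\dots,i_d\in\{1,\dots,n\}$ are pairwise distinct and $0$ otherwise; similarly $\mathfrak{D}^{(d)}f$, $\mathfrak{d}^{(d)}f$, $\mathfrak{d}^{\pm(d)}f$. $|\cdot|$ is the Euclidean (Hilbert–Schmidt) norm in $\mathbb{R}^{n^d}$. *)

theory Defs
  imports "HOL-Probability.Probability"
begin

text \<open>
  Functions of \<open>X = (X\<^sub>1, \<dots>, X\<^sub>n)\<close> are functions on the product space over the index set
  \<open>{1..n}\<close>; a random vector is obtained by plugging in \<^term>\<open>subvec X I \<omega>\<close>.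
  All coordinates share one carrier type, but each has its own measurable space \<open>N i\<close>.
\<close>

definition subvec :: "(nat \<Rightarrow> 'w \<Rightarrow> 'a) \<Rightarrow> nat set \<Rightarrow> 'w \<Rightarrow> nat \<Rightarrow> 'a" where
  "subvec X I \<omega> = (\<lambda>i\<in>I. X i \<omega>)"

definition law :: "'w measure \<Rightarrow> (nat \<Rightarrow> 'a measure) \<Rightarrow> (nat \<Rightarrow> 'w \<Rightarrow> 'a) \<Rightarrow> nat \<Rightarrow> 'a measure" where
  "law M N X i = distr M (N i) (X i)"

text \<open>
  Expectation with respect to the coordinates in \<open>I\<close> only, the others being kept fixed.
  The parameter \<open>\<mu>\<close> is the family of laws of the independent coordinates.
\<close>

definition pexp :: "(nat \<Rightarrow> 'a measure) \<Rightarrow> nat set \<Rightarrow> ((nat \<Rightarrow> 'a) \<Rightarrow> real) \<Rightarrow> (nat \<Rightarrow> 'a) \<Rightarrow> real" where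
  "pexp \<mu> I g x = (\<integral>y. g (override_on x y I) \<partial>(PiM I \<mu>))"

text \<open>The \<open>k\<close>-th order term; index sets of size \<open>k\<close> stand for \<open>i\<^sub>1 < \<dots> < i\<^sub>k\<close>.\<close>

definition hoeffding_term ::
  "'w measure \<Rightarrow> (nat \<Rightarrow> 'w \<Rightarrow> 'a) \<Rightarrow> nat \<Rightarrow> ((nat \<Rightarrow> 'a) \<Rightarrow> real) \<Rightarrow>
   (nat set \<Rightarrow> (nat \<Rightarrow> 'a) \<Rightarrow> real) \<Rightarrow> nat \<Rightarrow> 'w \<Rightarrow> real" where
  "hoeffding_term M X n f h k \<omega> =
     (if k = 0 then prob_space.expectation M (\<lambda>\<omega>'. f (subvec X {1..n} \<omega>'))
      else (\<Sum>I | I \<subseteq> {1..n} \<and> card I = k. h I (subvec X I \<omega>)))"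

text \<open>
  Integrability of the kernels is part of the notion: otherwise the Bochner integral,
  which is 0 on non-integrable functions, would make the condition on the partial
  expectations meaningless.
\<close>

definition hoeffding_decomposition ::
  "'w measure \<Rightarrow> (nat \<Rightarrow> 'a measure) \<Rightarrow> (nat \<Rightarrow> 'w \<Rightarrow> 'a) \<Rightarrow> nat \<Rightarrow> ((nat \<Rightarrow> 'a) \<Rightarrow> real) \<Rightarrow>
   (nat set \<Rightarrow> (nat \<Rightarrow> 'a) \<Rightarrow> real) \<Rightarrow> bool" where
  "hoeffding_decomposition M N X n f h \<longleftrightarrow>
     (\<forall>I. I \<subseteq> {1..n} \<and> I \<noteq> {} \<longrightarrow>
        h I \<in> borel_measurable (PiM I N) \<and>
        integrable M (\<lambda>\<omega>. h I (subvec X I \<omega>)) \<and>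
        (\<forall>i\<in>I. AE \<omega> in M. pexp (law M N X) {i} (h I) (subvec X I \<omega>) = 0)) \<and>
     (AE \<omega> in M. f (subvec X {1..n} \<omega>) = (\<Sum>k=0..n. hoeffding_term M X n f h k \<omega>))"

text \<open>A tuple \<open>(i\<^sub>1, \<dots>, i\<^sub>d)\<close> is a list of length \<open>d\<close>; products of operators are compositions.\<close>

definition frakD :: "(nat \<Rightarrow> 'a measure) \<Rightarrow> ((nat \<Rightarrow> 'a) \<Rightarrow> real) \<Rightarrow> nat list \<Rightarrow> (nat \<Rightarrow> 'a) \<Rightarrow> real" where
  "frakD \<mu> f is = foldr (\<lambda>i g x. g x - pexp \<mu> {i} g x) is f"

definition frakv :: "(nat \<Rightarrow> 'a measure) \<Rightarrow> ((nat \<Rightarrow> 'a) \<Rightarrow> real) \<Rightarrow> nat list \<Rightarrow> (nat \<Rightarrow> 'a) \<Rightarrow> real" where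
  "frakv \<mu> f is x = sqrt (pexp \<mu> (set is) (\<lambda>x'. (frakD \<mu> f is x')\<^sup>2) x)"

text \<open>
  The operators \<open>T\<^sub>i\<close> act on functions \<open>F x y\<close> of \<open>x = X\<close> and of its independent copy \<open>y\<close>.
\<close>

definition resample ::
  "nat \<Rightarrow> ((nat \<Rightarrow> 'a) \<Rightarrow> (nat \<Rightarrow> 'a) \<Rightarrow> real) \<Rightarrow> (nat \<Rightarrow> 'a) \<Rightarrow> (nat \<Rightarrow> 'a) \<Rightarrow> real" where
  "resample i F x y = F (x(i := y i)) y"

definition resample_diff ::
  "((nat \<Rightarrow> 'a) \<Rightarrow> real) \<Rightarrow> nat list \<Rightarrow> (nat \<Rightarrow> 'a) \<Rightarrow> (nat \<Rightarrow> 'a) \<Rightarrow> real" where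
  "resample_diff f is = foldr (\<lambda>i F x y. F x y - resample i F x y) is (\<lambda>x y. f x)"

text \<open>
  The integrals below are the expectations with respect to the copies of the coordinates in
  \<open>is\<close>: these are independent with the laws \<open>\<mu> i\<close>, and \<^term>\<open>resample_diff f is x y\<close> depends
  on \<open>y\<close> only through these coordinates.
\<close>

definition frakd :: "(nat \<Rightarrow> 'a measure) \<Rightarrow> ((nat \<Rightarrow> 'a) \<Rightarrow> real) \<Rightarrow> nat list \<Rightarrow> (nat \<Rightarrow> 'a) \<Rightarrow> real" where
  "frakd \<mu> f is x =
     sqrt (1 / 2 ^ length is * (\<integral>y. (resample_diff f is x y)\<^sup>2 \<partial>(PiM (set is) \<mu>)))"

definition frakd_plus :: "(nat \<Rightarrow> 'a measure) \<Rightarrow> ((nat \<Rightarrow> 'a) \<Rightarrow> real) \<Rightarrow> nat list \<Rightarrow> (nat \<Rightarrow> 'a) \<Rightarrow> real" where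
  "frakd_plus \<mu> f is x =
     sqrt (1 / 2 ^ length is * (\<integral>y. (max (resample_diff f is x y) 0)\<^sup>2 \<partial>(PiM (set is) \<mu>)))"

definition frakd_minus :: "(nat \<Rightarrow> 'a measure) \<Rightarrow> ((nat \<Rightarrow> 'a) \<Rightarrow> real) \<Rightarrow> nat list \<Rightarrow> (nat \<Rightarrow> 'a) \<Rightarrow> real" where
  "frakd_minus \<mu> f is x =
     sqrt (1 / 2 ^ length is * (\<integral>y. (max (- resample_diff f is x y) 0)\<^sup>2 \<partial>(PiM (set is) \<mu>)))"

definition hypermatrix :: "nat \<Rightarrow> (nat list \<Rightarrow> 'b \<Rightarrow> real) \<Rightarrow> 'b \<Rightarrow> nat list \<Rightarrow> real" where
  "hypermatrix n a x is = (if set is \<subseteq> {1..n} \<and> distinct is then a is x else 0)"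

definition hs_norm :: "nat \<Rightarrow> nat \<Rightarrow> (nat list \<Rightarrow> real) \<Rightarrow> real" where
  "hs_norm n d A = L2_set A {is. length is = d \<and> set is \<subseteq> {1..n}}"

definition mean_sq_norm ::
  "'w measure \<Rightarrow> (nat \<Rightarrow> 'w \<Rightarrow> 'a) \<Rightarrow> nat \<Rightarrow> nat \<Rightarrow> (nat list \<Rightarrow> (nat \<Rightarrow> 'a) \<Rightarrow> real) \<Rightarrow> real" where
  "mean_sq_norm M X n d a =
     prob_space.expectation M (\<lambda>\<omega>. (hs_norm n d (hypermatrix n a (subvec X {1..n} \<omega>)))\<^sup>2)"

end

theory Submission
  imports Defs "HOL-Combinatorics.Multiset_Permutations"
begin

text \<open>
  Write \<open>f = \<Sum>\<^sub>J H J\<close> with degenerate kernels \<open>H J\<close>, where \<open>J\<close> ranges over the subsets of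
  \<open>{1..n}\<close>. They are pairwise orthogonal in \<open>L\<^sup>2\<close>, and averaging over the coordinates in \<open>K\<close> kills
  \<open>H J\<close> if \<open>J\<close> meets \<open>K\<close> and fixes it otherwise. Hence \<open>\<DD>\<^sub>A f = \<Sum>\<^sub>J\<^sub>\<supseteq>\<^sub>A H J\<close>. The square of the
  resampling difference over \<open>A\<close> has mean \<open>2\<close> to the \<open>|A|\<close> times the energy of \<open>\<DD>\<^sub>A f\<close>, and exchanging
  one coordinate of \<open>X\<close> with its copy flips the sign of this difference, so its positive and its
  negative part carry half of that each. Therefore all five bounds are equal to
  \<open>\<Sum>\<^sub>J (|J| choose d) \<parallel>H J\<parallel>\<^sup>2\<close>, while the variance is \<open>\<Sum>\<^sub>J \<parallel>H J\<parallel>\<^sup>2\<close> over \<open>|J| \<ge> d\<close>, and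
  \<open>|J| choose d\<close> exceeds \<open>1\<close> exactly when \<open>|J| > d\<close>.
\<close>

subsection \<open>Averaging and swapping coordinates in product spaces\<close>

context finite_product_prob_space
begin

interpretation PP: pair_prob_space "Pi\<^sub>M I M" "Pi\<^sub>M I M" ..

lemma measurable_override_on [measurable]:
  assumes "u \<in> measurable S (Pi\<^sub>M I M)" "v \<in> measurable S (Pi\<^sub>M I M)"
  shows "(\<lambda>z. override_on (u z) (v z) K) \<in> measurable S (Pi\<^sub>M I M)"
  unfolding override_on_def
proof (rule measurable_PiM_single')
  show "(\<lambda>z. if i \<in> K then v z i else u z i) \<in> measurable S (M i)" if "i \<in> I" for i
    using assms[THEN measurable_compose[OF _ measurable_component_singleton[OF that]]]
    by (cases "i \<in> K") auto
  show "(\<lambda>z i. if i \<in> K then v z i else u z i) \<in> space S \<rightarrow> (\<Pi>\<^sub>E i\<in>I. space (M i))"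
    using assms[THEN measurable_space] by (fastforce simp: space_PiM PiE_iff extensional_def)
qed

lemma override_on_in_space:
  assumes "x \<in> space (Pi\<^sub>M I M)" "y \<in> space (Pi\<^sub>M I M)"
  shows "override_on x y K \<in> space (Pi\<^sub>M I M)"
  using assms by (fastforce simp: space_PiM PiE_iff extensional_def override_on_def)

definition swap_on :: "'a set \<Rightarrow> ('a \<Rightarrow> 'b) \<times> ('a \<Rightarrow> 'b) \<Rightarrow> ('a \<Rightarrow> 'b) \<times> ('a \<Rightarrow> 'b)" where
  "swap_on K z = (override_on (fst z) (snd z) K, override_on (snd z) (fst z) K)"

lemma measurable_swap_on [measurable]:
  "swap_on K \<in> measurable (Pi\<^sub>M I M \<Otimes>\<^sub>M Pi\<^sub>M I M) (Pi\<^sub>M I M \<Otimes>\<^sub>M Pi\<^sub>M I M)"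
  unfolding swap_on_def by measurable

text \<open>Two independent vectors are one vector indexed by \<open>I \<times> UNIV\<close>, where
  the boolean tells the original from the copy. Exchanging the coordinates in \<open>K\<close> only
  relabels the indices, which preserves a product measure.\<close>

lemma distr_swap_on:
  "distr (Pi\<^sub>M I M \<Otimes>\<^sub>M Pi\<^sub>M I M) (Pi\<^sub>M I M \<Otimes>\<^sub>M Pi\<^sub>M I M) (swap_on K) = Pi\<^sub>M I M \<Otimes>\<^sub>M Pi\<^sub>M I M"
proof -
  let ?P = "Pi\<^sub>M I M" and ?B = "I \<times> (UNIV :: bool set)"
  let ?Q = "Pi\<^sub>M ?B (\<lambda>j. M (fst j))"
  interpret Q: product_sigma_finite "\<lambda>j :: 'a \<times> bool. M (fst j)"
    by standard
  define \<phi> :: "('a \<times> bool \<Rightarrow> 'b) \<Rightarrow> ('a \<Rightarrow> 'b) \<times> ('a \<Rightarrow> 'b)"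
    where "\<phi> w = ((\<lambda>i\<in>I. w (i, False)), (\<lambda>i\<in>I. w (i, True)))" for w
  \<comment> \<open>\<open>\<psi> K\<close> glues a pair together with the roles of original and
    copy exchanged on \<open>K\<close>, and \<open>\<phi>\<close> takes a glued vector apart
    again.\<close>
  define \<psi> :: "'a set \<Rightarrow> ('a \<Rightarrow> 'b) \<times> ('a \<Rightarrow> 'b) \<Rightarrow> 'a \<times> bool \<Rightarrow> 'b"
    where "\<psi> K z = (\<lambda>j\<in>?B. if snd j \<noteq> (fst j \<in> K) then snd z (fst j) else fst z (fst j))" for K z
  have comp: "(\<lambda>w. w (i, b)) \<in> measurable ?Q (M i)" if "i \<in> I" for i b
    using measurable_component_singleton[of "(i, b)" ?B "\<lambda>j. M (fst j)"] that by simp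
  have [measurable]: "\<phi> \<in> measurable ?Q (?P \<Otimes>\<^sub>M ?P)"
    unfolding \<phi>_def by (intro measurable_Pair measurable_restrict comp)
  have [measurable]: "\<psi> K \<in> measurable (?P \<Otimes>\<^sub>M ?P) ?Q" for K
    unfolding \<psi>_def
  proof (rule measurable_restrict)
    fix j :: "'a \<times> bool" assume "j \<in> ?B"
    then have "fst j \<in> I" by auto
    note * = measurable_component_singleton[OF this]
    show "(\<lambda>z. if snd j \<noteq> (fst j \<in> K) then snd z (fst j) else fst z (fst j))
        \<in> measurable (?P \<Otimes>\<^sub>M ?P) (M (fst j))"
      using measurable_compose[OF measurable_fst *] measurable_compose[OF measurable_snd *]
      by (cases "snd j \<noteq> (fst j \<in> K)") (simp_all del: not_iff)
  qed
  \<comment> \<open>Checked on boxes: for each \<open>i\<close> the two side masses appear in an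
    order that depends on whether \<open>i \<in> K\<close>, but their product does not.\<close>
  have distr_\<psi>: "distr (?P \<Otimes>\<^sub>M ?P) ?Q (\<psi> K) = ?Q" for K
  proof (rule Q.PiM_eqI)
    show "finite ?B" using finite_index by simp
    fix A :: "'a \<times> bool \<Rightarrow> 'b set" assume A: "\<And>j. j \<in> ?B \<Longrightarrow> A j \<in> sets (M (fst j))"
    have Ai: "A (i, b) \<in> sets (M i)" if "i \<in> I" for i b
      using A[of "(i, b)"] that by simp
    have sub: "A (i, b) \<subseteq> space (M i)" if "i \<in> I" for i b
      using Ai[OF that] sets.sets_into_space by blast
    have pre: "\<psi> K -` Pi\<^sub>E ?B A \<inter> space (?P \<Otimes>\<^sub>M ?P) =
        (\<Pi>\<^sub>E i\<in>I. A (i, i \<in> K)) \<times> (\<Pi>\<^sub>E i\<in>I. A (i, i \<notin> K))" (is "?L = ?R")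
    proof (intro equalityI subsetI)
      fix z assume *: "z \<in> ?L"
      have mem: "\<psi> K z (i, b) \<in> A (i, b)" if "i \<in> I" for i b
        using * that by (auto simp: PiE_iff)
      have "fst z i \<in> A (i, i \<in> K) \<and> snd z i \<in> A (i, i \<notin> K)" if "i \<in> I" for i
        using mem[OF that, of "i \<in> K"] mem[OF that, of "i \<notin> K"] that
        by (simp add: \<psi>_def split: if_splits)
      with * show "z \<in> ?R"
        by (cases z) (auto simp: space_pair_measure space_PiM PiE_iff)
    next
      fix z assume *: "z \<in> ?R"
      then have "z \<in> space (?P \<Otimes>\<^sub>M ?P)"
        using sub by (cases z) (fastforce simp: space_pair_measure space_PiM PiE_iff)
      moreover have "\<psi> K z \<in> Pi\<^sub>E ?B A"
        unfolding PiE_iff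
      proof safe
        fix i b assume "i \<in> I"
        moreover from * this have "fst z i \<in> A (i, i \<in> K)" "snd z i \<in> A (i, i \<notin> K)"
          by (auto simp: PiE_iff)
        ultimately show "\<psi> K z (i, b) \<in> A (i, b)"
          by (cases "i \<in> K"; cases b) (simp_all add: \<psi>_def)
      qed (auto simp: \<psi>_def)
      ultimately show "z \<in> ?L" by simp
    qed
    have "emeasure (distr (?P \<Otimes>\<^sub>M ?P) ?Q (\<psi> K)) (Pi\<^sub>E ?B A) =
        emeasure (?P \<Otimes>\<^sub>M ?P) ((\<Pi>\<^sub>E i\<in>I. A (i, i \<in> K)) \<times> (\<Pi>\<^sub>E i\<in>I. A (i, i \<notin> K)))"
      using A finite_index by (subst emeasure_distr) (auto intro!: sets_PiM_I_finite simp: pre)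
    also have "\<dots> = (\<Prod>i\<in>I. emeasure (M i) (A (i, i \<in> K))) * (\<Prod>i\<in>I. emeasure (M i) (A (i, i \<notin> K)))"
    proof -
      have "(\<Pi>\<^sub>E i\<in>I. A (i, b i)) \<in> sets ?P" for b
        by (rule sets_PiM_I_finite[OF finite_index]) (rule Ai)
      moreover have "emeasure ?P (\<Pi>\<^sub>E i\<in>I. A (i, b i)) = (\<Prod>i\<in>I. emeasure (M i) (A (i, b i)))" for b
        by (rule emeasure_PiM[OF finite_index]) (rule Ai)
      ultimately show ?thesis
        by (simp only: emeasure_pair_measure_Times)
    qed
    also have "\<dots> = (\<Prod>i\<in>I. \<Prod>b\<in>UNIV. emeasure (M i) (A (i, b)))"
    proof (subst prod.distrib[symmetric], rule prod.cong[OF refl])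
      fix i
      show "emeasure (M i) (A (i, i \<in> K)) * emeasure (M i) (A (i, i \<notin> K)) =
          (\<Prod>b\<in>UNIV. emeasure (M i) (A (i, b)))"
        by (cases "i \<in> K") (simp_all add: UNIV_bool mult.commute)
    qed
    also have "\<dots> = (\<Prod>j\<in>?B. emeasure (M (fst j)) (A j))"
      by (subst prod.cartesian_product) (simp add: case_prod_beta)
    finally show "emeasure (distr (?P \<Otimes>\<^sub>M ?P) ?Q (\<psi> K)) (Pi\<^sub>E ?B A) =
        (\<Prod>j\<in>?B. emeasure (M (fst j)) (A j))" .
  qed simp
  \<comment> \<open>The left side is free of \<open>K\<close>, so every swap has the same image
    measure as the swap over \<open>{}\<close>, which is the identity.\<close>
  have \<phi>\<psi>: "distr ?Q (?P \<Otimes>\<^sub>M ?P) \<phi> = distr (?P \<Otimes>\<^sub>M ?P) (?P \<Otimes>\<^sub>M ?P) (swap_on K)" for K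
  proof -
    have "distr ?Q (?P \<Otimes>\<^sub>M ?P) \<phi> = distr (?P \<Otimes>\<^sub>M ?P) (?P \<Otimes>\<^sub>M ?P) (\<phi> \<circ> \<psi> K)"
      by (subst distr_\<psi>[of K, symmetric], subst distr_distr) simp_all
    also have "\<dots> = distr (?P \<Otimes>\<^sub>M ?P) (?P \<Otimes>\<^sub>M ?P) (swap_on K)"
    proof (rule distr_cong)
      fix z assume "z \<in> space (?P \<Otimes>\<^sub>M ?P)"
      then show "(\<phi> \<circ> \<psi> K) z = swap_on K z"
        by (cases z) (auto simp: \<phi>_def \<psi>_def swap_on_def space_pair_measure space_PiM
            override_on_def fun_eq_iff PiE_iff extensional_def)
    qed simp_all
    finally show ?thesis .
  qed
  have "distr (?P \<Otimes>\<^sub>M ?P) (?P \<Otimes>\<^sub>M ?P) (swap_on {}) = ?P \<Otimes>\<^sub>M ?P"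
  proof -
    have "swap_on {} = (\<lambda>z :: ('a \<Rightarrow> 'b) \<times> ('a \<Rightarrow> 'b). z)"
      by (simp add: swap_on_def fun_eq_iff)
    then show ?thesis by (simp only: distr_id)
  qed
  then show ?thesis
    using \<phi>\<psi>[of K] \<phi>\<psi>[of "{}"] by simp
qed

text \<open>The overridden vector is the first component of a swapped pair.\<close>

lemma distr_override_on:
  "distr (Pi\<^sub>M I M \<Otimes>\<^sub>M Pi\<^sub>M I M) (Pi\<^sub>M I M) (\<lambda>z. override_on (fst z) (snd z) K) = Pi\<^sub>M I M"
proof -
  let ?P = "Pi\<^sub>M I M"
  have "distr (?P \<Otimes>\<^sub>M ?P) ?P (\<lambda>z. override_on (fst z) (snd z) K) =
      distr (distr (?P \<Otimes>\<^sub>M ?P) (?P \<Otimes>\<^sub>M ?P) (swap_on K)) ?P fst"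
    by (subst distr_distr) (auto simp: comp_def swap_on_def)
  also have "\<dots> = ?P"
    unfolding distr_swap_on by (rule distr_pair_fst)
  finally show ?thesis .
qed

text \<open>This is the partial expectation over \<open>K\<close>, with \<open>y\<close> drawn on
  all of \<open>I\<close> although only its coordinates in \<open>K\<close> enter. All averages then
  live on the same pair space, where the swap invariance applies.\<close>

definition ave :: "'a set \<Rightarrow> (('a \<Rightarrow> 'b) \<Rightarrow> real) \<Rightarrow> ('a \<Rightarrow> 'b) \<Rightarrow> real" where
  "ave K g x = (\<integral>y. g (override_on x y K) \<partial>Pi\<^sub>M I M)"

lemma measurable_ave [measurable]:
  assumes [measurable]: "g \<in> borel_measurable (Pi\<^sub>M I M)"
  shows "ave K g \<in> borel_measurable (Pi\<^sub>M I M)"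
  unfolding ave_def by measurable

lemma integrable_override_on:
  fixes g :: "('a \<Rightarrow> 'b) \<Rightarrow> real"
  assumes "integrable (Pi\<^sub>M I M) g"
  shows "integrable (Pi\<^sub>M I M \<Otimes>\<^sub>M Pi\<^sub>M I M) (\<lambda>z. g (override_on (fst z) (snd z) K))"
  by (rule integrable_distr[where M'="Pi\<^sub>M I M"]) (measurable, subst distr_override_on, rule assms)

lemma integral_override_on:
  fixes g :: "('a \<Rightarrow> 'b) \<Rightarrow> real"
  assumes [measurable]: "g \<in> borel_measurable (Pi\<^sub>M I M)"
  shows "(\<integral>z. g (override_on (fst z) (snd z) K) \<partial>(Pi\<^sub>M I M \<Otimes>\<^sub>M Pi\<^sub>M I M)) = (\<integral>x. g x \<partial>Pi\<^sub>M I M)"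
proof -
  have "(\<integral>x. g x \<partial>Pi\<^sub>M I M) = (\<integral>x. g x \<partial>distr (Pi\<^sub>M I M \<Otimes>\<^sub>M Pi\<^sub>M I M) (Pi\<^sub>M I M)
      (\<lambda>z. override_on (fst z) (snd z) K))"
    by (simp only: distr_override_on)
  then show ?thesis
    by (simp add: integral_distr)
qed

lemma AE_override_on:
  assumes "AE x in Pi\<^sub>M I M. Q x"
  shows "AE z in Pi\<^sub>M I M \<Otimes>\<^sub>M Pi\<^sub>M I M. Q (override_on (fst z) (snd z) K)"
  by (rule AE_distrD[where M'="Pi\<^sub>M I M"]) (measurable, subst distr_override_on, rule assms)

lemma integral_swap_on:
  fixes G :: "('a \<Rightarrow> 'b) \<times> ('a \<Rightarrow> 'b) \<Rightarrow> real"
  assumes [measurable]: "G \<in> borel_measurable (Pi\<^sub>M I M \<Otimes>\<^sub>M Pi\<^sub>M I M)"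
  shows "(\<integral>z. G (swap_on K z) \<partial>(Pi\<^sub>M I M \<Otimes>\<^sub>M Pi\<^sub>M I M)) = (\<integral>z. G z \<partial>(Pi\<^sub>M I M \<Otimes>\<^sub>M Pi\<^sub>M I M))"
proof -
  have "(\<integral>z. G z \<partial>(Pi\<^sub>M I M \<Otimes>\<^sub>M Pi\<^sub>M I M)) = (\<integral>z. G z \<partial>distr (Pi\<^sub>M I M \<Otimes>\<^sub>M Pi\<^sub>M I M)
      (Pi\<^sub>M I M \<Otimes>\<^sub>M Pi\<^sub>M I M) (swap_on K))"
    by (simp only: distr_swap_on)
  then show ?thesis
    by (simp add: integral_distr)
qed

lemma integrable_ave:
  assumes "integrable (Pi\<^sub>M I M) g"
  shows "integrable (Pi\<^sub>M I M) (ave K g)"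
  using PP.integrable_fst'[OF integrable_override_on[OF assms, of K]] by (simp add: ave_def[abs_def])

lemma AE_integrable_override_on:
  fixes g :: "('a \<Rightarrow> 'b) \<Rightarrow> real"
  assumes "integrable (Pi\<^sub>M I M) g"
  shows "AE x in Pi\<^sub>M I M. integrable (Pi\<^sub>M I M) (\<lambda>y. g (override_on x y K))"
  using PP.AE_integrable_fst'[OF integrable_override_on[OF assms, of K]] by simp

lemma integral_ave:
  assumes "integrable (Pi\<^sub>M I M) g"
  shows "(\<integral>x. ave K g x \<partial>Pi\<^sub>M I M) = (\<integral>x. g x \<partial>Pi\<^sub>M I M)"
  using PP.integral_fst'[OF integrable_override_on[OF assms, of K]] integral_override_on[of g K] assms
  by (simp add: ave_def[abs_def])

text \<open>By Fubini, for almost every \<open>x\<close> the identity holds almost everywhere along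
  the fibre and all summands are integrable there, so the Bochner integral is additive on that
  fibre.\<close>

lemma AE_ave_sum:
  assumes "AE x in Pi\<^sub>M I M. g x = (\<Sum>J\<in>\<J>. G J x)"
    and [measurable]: "g \<in> borel_measurable (Pi\<^sub>M I M)"
    and G: "\<And>J. J \<in> \<J> \<Longrightarrow> integrable (Pi\<^sub>M I M) (G J)" and "finite \<J>"
  shows "AE x in Pi\<^sub>M I M. ave K g x = (\<Sum>J\<in>\<J>. ave K (G J) x)"
proof -
  have "AE x in Pi\<^sub>M I M. AE y in Pi\<^sub>M I M. g (override_on x y K) = (\<Sum>J\<in>\<J>. G J (override_on x y K))"
    using PP.AE_pair[OF AE_override_on[OF assms(1), of K]] by simp
  moreover have "AE x in Pi\<^sub>M I M. \<forall>J\<in>\<J>. integrable (Pi\<^sub>M I M) (\<lambda>y. G J (override_on x y K))"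
    using \<open>finite \<J>\<close> G by (simp add: AE_finite_all AE_integrable_override_on)
  ultimately show ?thesis
    using AE_space
  proof eventually_elim
    case (elim x)
    then have [measurable]: "(\<lambda>y. override_on x y K) \<in> measurable (Pi\<^sub>M I M) (Pi\<^sub>M I M)"
      by (auto intro: measurable_override_on)
    have [measurable]: "G J \<in> borel_measurable (Pi\<^sub>M I M)" if "J \<in> \<J>" for J
      using G[OF that] by auto
    have "ave K g x = (\<integral>y. (\<Sum>J\<in>\<J>. G J (override_on x y K)) \<partial>Pi\<^sub>M I M)"
      unfolding ave_def using elim by (intro integral_cong_AE) auto
    also have "\<dots> = (\<Sum>J\<in>\<J>. ave K (G J) x)"
      unfolding ave_def using elim by (intro Bochner_Integration.integral_sum) auto
    finally show ?case .
  qed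
qed

section \<open>Square integrability and correlation with a partial average\<close>

lemma integrable_mult_of_squares:
  fixes g k :: "'c \<Rightarrow> real"
  assumes [measurable]: "g \<in> borel_measurable S" "k \<in> borel_measurable S"
    and "integrable S (\<lambda>x. (g x)\<^sup>2)" "integrable S (\<lambda>x. (k x)\<^sup>2)"
  shows "integrable S (\<lambda>x. g x * k x)"
proof (rule Bochner_Integration.integrable_bound)
  show "integrable S (\<lambda>x. (g x)\<^sup>2 + (k x)\<^sup>2)"
    using assms by simp
  have "\<bar>a * b\<bar> \<le> a\<^sup>2 + b\<^sup>2" for a b :: real
  proof -
    have "0 \<le> \<bar>a\<bar> * \<bar>b\<bar>" by simp
    then show ?thesis
      using sum_squares_bound[of "\<bar>a\<bar>" "\<bar>b\<bar>"] unfolding abs_mult power2_abs by linarith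
  qed
  then show "AE x in S. norm (g x * k x) \<le> norm ((g x)\<^sup>2 + (k x)\<^sup>2)"
    by simp
qed simp

lemma integrable_square_sum:
  fixes G :: "'d \<Rightarrow> 'c \<Rightarrow> real"
  assumes "finite A" "\<And>i. i \<in> A \<Longrightarrow> G i \<in> borel_measurable S"
    and "\<And>i. i \<in> A \<Longrightarrow> integrable S (\<lambda>x. (G i x)\<^sup>2)"
  shows "integrable S (\<lambda>x. (\<Sum>i\<in>A. G i x)\<^sup>2)"
proof -
  have "(\<lambda>x. (\<Sum>i\<in>A. G i x)\<^sup>2) = (\<lambda>x. \<Sum>i\<in>A. \<Sum>j\<in>A. G i x * G j x)"
    by (simp add: power2_eq_square sum_product)
  moreover have "integrable S (\<lambda>x. G i x * G j x)" if "i \<in> A" "j \<in> A" for i j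
    using assms that by (intro integrable_mult_of_squares) auto
  ultimately show ?thesis
    by simp
qed

lemma integrable_of_square:
  assumes [measurable]: "g \<in> borel_measurable (Pi\<^sub>M I M)" and "integrable (Pi\<^sub>M I M) (\<lambda>x. (g x :: real)\<^sup>2)"
  shows "integrable (Pi\<^sub>M I M) g"
  using integrable_mult_of_squares[of g "Pi\<^sub>M I M" "\<lambda>_. 1"] assms by simp

lemma integrable_ave_square:
  assumes [measurable]: "g \<in> borel_measurable (Pi\<^sub>M I M)" and g2: "integrable (Pi\<^sub>M I M) (\<lambda>x. (g x)\<^sup>2)"
  shows "integrable (Pi\<^sub>M I M) (\<lambda>x. (ave K g x)\<^sup>2)"
proof (rule Bochner_Integration.integrable_bound)
  show "integrable (Pi\<^sub>M I M) (ave K (\<lambda>x. (g x)\<^sup>2))"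
    by (rule integrable_ave[OF g2])
  have g1: "integrable (Pi\<^sub>M I M) g"
    by (rule integrable_of_square) (use assms in auto)
  show "AE x in Pi\<^sub>M I M. norm ((ave K g x)\<^sup>2) \<le> norm (ave K (\<lambda>x. (g x)\<^sup>2) x)"
    using AE_integrable_override_on[OF g1, of K] AE_integrable_override_on[OF g2, of K]
  proof eventually_elim
    case (elim x)
    \<comment> \<open>Jensen's inequality on a fibre, in the form that a variance is
      nonnegative.\<close>
    then have "(ave K g x)\<^sup>2 \<le> ave K (\<lambda>x. (g x)\<^sup>2) x"
      using variance_positive[of "\<lambda>y. g (override_on x y K)"] by (simp add: variance_eq ave_def)
    then show ?case by simp
  qed
qed simp

text \<open>Fubini: \<open>g (fst z)\<close> is constant in the inner integral, which therefore
  averages \<open>k\<close> alone.\<close>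

lemma integral_mult_ave:
  fixes g k :: "('a \<Rightarrow> 'b) \<Rightarrow> real"
  assumes [measurable]: "g \<in> borel_measurable (Pi\<^sub>M I M)" "k \<in> borel_measurable (Pi\<^sub>M I M)"
    and g2: "integrable (Pi\<^sub>M I M) (\<lambda>x. (g x)\<^sup>2)" and k2: "integrable (Pi\<^sub>M I M) (\<lambda>x. (k x)\<^sup>2)"
  shows "(\<integral>z. g (fst z) * k (override_on (fst z) (snd z) K) \<partial>(Pi\<^sub>M I M \<Otimes>\<^sub>M Pi\<^sub>M I M)) =
    (\<integral>x. g x * ave K k x \<partial>Pi\<^sub>M I M)"
proof -
  have "integrable (Pi\<^sub>M I M \<Otimes>\<^sub>M Pi\<^sub>M I M) (\<lambda>z. g (fst z) * k (override_on (fst z) (snd z) K))"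
    \<comment> \<open>Overriding on \<open>{}\<close> returns \<open>fst z\<close>, so the same fact
      covers the first factor.\<close>
    using integrable_override_on[OF g2, of "{}"] integrable_override_on[OF k2, of K]
    by (intro integrable_mult_of_squares) simp_all
  from PP.integral_fst'[OF this] show ?thesis
    by (simp add: ave_def)
qed

end

subsection \<open>Orthogonality of degenerate kernels\<close>

text \<open>The decomposition seen on the product of the laws. Every kernel is a function of the
  whole vector, and \<open>H_local\<close> records that only the coordinates in \<open>J\<close>
  matter; thus all kernels sit on one space. \<open>H {}\<close> carries the constant term.\<close>

locale hoeffding_kernels = finite_product_prob_space M I
  for M :: "nat \<Rightarrow> 'a measure" and I :: "nat set" +
  fixes f :: "(nat \<Rightarrow> 'a) \<Rightarrow> real" and H :: "nat set \<Rightarrow> (nat \<Rightarrow> 'a) \<Rightarrow> real"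
  assumes f_measurable [measurable]: "f \<in> borel_measurable (Pi\<^sub>M I M)"
    and f_square: "integrable (Pi\<^sub>M I M) (\<lambda>x. (f x)\<^sup>2)"
    and H_integrable: "\<And>J. J \<subseteq> I \<Longrightarrow> integrable (Pi\<^sub>M I M) (H J)"
    and H_local: "\<And>J x y. J \<subseteq> I \<Longrightarrow> x \<in> space (Pi\<^sub>M I M) \<Longrightarrow> y \<in> space (Pi\<^sub>M I M) \<Longrightarrow>
      (\<And>i. i \<in> J \<Longrightarrow> x i = y i) \<Longrightarrow> H J x = H J y"
    and H_degenerate: "\<And>J i. J \<subseteq> I \<Longrightarrow> i \<in> J \<Longrightarrow> AE x in Pi\<^sub>M I M. ave {i} (H J) x = 0"
    and f_decomp: "AE x in Pi\<^sub>M I M. f x = (\<Sum>J\<in>Pow I. H J x)"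
begin

interpretation PP: pair_prob_space "Pi\<^sub>M I M" "Pi\<^sub>M I M" ..

lemma H_measurable [measurable]: "J \<subseteq> I \<Longrightarrow> H J \<in> borel_measurable (Pi\<^sub>M I M)"
  using H_integrable by blast

lemma ave_H_disjoint:
  assumes "J \<subseteq> I" "J \<inter> K = {}" "x \<in> space (Pi\<^sub>M I M)"
  shows "ave K (H J) x = H J x"
proof -
  have "ave K (H J) x = (\<integral>y. H J x \<partial>Pi\<^sub>M I M)"
    unfolding ave_def
  proof (rule Bochner_Integration.integral_cong)
    fix y assume "y \<in> space (Pi\<^sub>M I M)"
    then show "H J (override_on x y K) = H J x"
      using assms by (intro H_local override_on_in_space) (auto simp: override_on_def)
  qed simp
  then show ?thesis by (simp add: P.prob_space)
qed

text \<open>For \<open>i\<close> in both \<open>J\<close> and \<open>K\<close>, the average over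
  \<open>K\<close> can be preceded by one over \<open>{i}\<close> without changing its value, and
  that inner average vanishes by degeneracy.\<close>

lemma AE_ave_H_meets:
  assumes "J \<subseteq> I" "J \<inter> K \<noteq> {}"
  shows "AE x in Pi\<^sub>M I M. ave K (H J) x = 0"
proof -
  obtain i where i: "i \<in> J" "i \<in> K"
    using assms by blast
  have "AE x in Pi\<^sub>M I M. AE y in Pi\<^sub>M I M. ave {i} (H J) (override_on x y K) = 0"
    using PP.AE_pair[OF AE_override_on[OF H_degenerate[OF assms(1) i(1)], of K]] by simp
  then show ?thesis
    using AE_integrable_override_on[OF H_integrable[OF assms(1)], of K]
  proof eventually_elim
    case (elim x)
    \<comment> \<open>Since \<open>i \<in> K\<close>, resampling coordinate \<open>i\<close> of
      \<open>y\<close> before inserting it into \<open>x\<close> is the same as resampling it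
      afterwards.\<close>
    have "override_on x (override_on y y' {i}) K = override_on (override_on x y K) y' {i}" for y y'
      using i by (auto simp: override_on_def fun_eq_iff)
    then have "ave {i} (\<lambda>y. H J (override_on x y K)) y = ave {i} (H J) (override_on x y K)" for y
      by (simp add: ave_def)
    then have "ave K (H J) x = (\<integral>y. ave {i} (H J) (override_on x y K) \<partial>Pi\<^sub>M I M)"
      using integral_ave[OF elim(2), of "{i}"] by (simp add: ave_def)
    also have "\<dots> = 0"
      using elim(1) by (rule integral_eq_zero_AE)
    finally show ?case .
  qed
qed

lemma AE_ave_H:
  assumes "\<J> \<subseteq> Pow I"
  shows "AE x in Pi\<^sub>M I M. \<forall>J\<in>\<J>. ave K (H J) x = (if J \<inter> K = {} then H J x else 0)"
proof -
  have "AE x in Pi\<^sub>M I M. ave K (H J) x = (if J \<inter> K = {} then H J x else 0)" if "J \<in> \<J>" for J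
    using ave_H_disjoint[of J K] AE_ave_H_meets[of J K] that assms
    by (cases "J \<inter> K = {}") auto
  moreover have "finite \<J>"
    using assms finite_index finite_subset by blast
  ultimately show ?thesis
    by (simp add: AE_finite_all)
qed

lemma AE_ave_sum_H:
  assumes "\<J> \<subseteq> Pow I" and "AE x in Pi\<^sub>M I M. g x = (\<Sum>J\<in>\<J>. H J x)"
    and "g \<in> borel_measurable (Pi\<^sub>M I M)"
  shows "AE x in Pi\<^sub>M I M. ave K g x = (\<Sum>J | J \<in> \<J> \<and> J \<inter> K = {}. H J x)"
proof -
  have fin: "finite \<J>"
    using assms finite_index finite_subset by blast
  have "AE x in Pi\<^sub>M I M. ave K g x = (\<Sum>J\<in>\<J>. ave K (H J) x)"
    by (rule AE_ave_sum) (use assms fin H_integrable in auto)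
  then show ?thesis
    using AE_ave_H[OF assms(1), of K]
    by eventually_elim (simp add: sum.inter_filter[OF fin] cong: sum.cong)
qed

lemma AE_ave_f: "AE x in Pi\<^sub>M I M. ave K f x = (\<Sum>J\<in>Pow (I - K). H J x)"
proof -
  have "{J \<in> Pow I. J \<inter> K = {}} = Pow (I - K)" by auto
  then show ?thesis
    using AE_ave_sum_H[OF subset_refl f_decomp f_measurable, of K] by simp
qed

text \<open>Averaging \<open>f\<close> over the coordinates outside \<open>J\<close> expresses \<open>H J\<close> by \<open>f\<close> and the kernels
  of proper subsets of \<open>J\<close>, so square integrability passes from \<open>f\<close> to the kernels.\<close>

lemma H_square_integrable:
  assumes "J \<subseteq> I"
  shows "integrable (Pi\<^sub>M I M) (\<lambda>x. (H J x)\<^sup>2)"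
proof -
  have "finite J" using assms finite_index finite_subset by blast
  then show ?thesis using assms
  proof (induction rule: finite_psubset_induct)
    case (psubset J)
    let ?g = "\<lambda>x. \<Sum>L\<in>Pow J - {J}. H L x"
    note [measurable] = H_measurable[OF psubset.prems]
    have [measurable]: "?g \<in> borel_measurable (Pi\<^sub>M I M)"
      using psubset.prems by (intro borel_measurable_sum H_measurable) auto
    have g: "integrable (Pi\<^sub>M I M) (\<lambda>x. (?g x)\<^sup>2)"
      using psubset by (intro integrable_square_sum H_measurable) auto
    have a: "integrable (Pi\<^sub>M I M) (\<lambda>x. (ave (I - J) f x)\<^sup>2)"
      by (rule integrable_ave_square[OF f_measurable f_square])
    have "integrable (Pi\<^sub>M I M) (\<lambda>x. ave (I - J) f x * ?g x)"
      by (rule integrable_mult_of_squares) (use a g in auto)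
    then have int: "integrable (Pi\<^sub>M I M) (\<lambda>x. (ave (I - J) f x - ?g x)\<^sup>2)"
      using a g by (simp add: power2_diff mult.assoc)
    have "I - (I - J) = J" using psubset.prems by auto
    then have "AE x in Pi\<^sub>M I M. (H J x)\<^sup>2 = (ave (I - J) f x - ?g x)\<^sup>2"
      using AE_ave_f[of "I - J"] \<open>finite J\<close>
      by (auto elim!: eventually_mono simp: sum.remove[of "Pow J" J])
    from integrable_cong_AE[OF _ _ this] int show ?case by simp
  qed
qed

lemma integrable_H_mult:
  assumes "J \<subseteq> I" "L \<subseteq> I"
  shows "integrable (Pi\<^sub>M I M) (\<lambda>x. H J x * H L x)"
  using assms by (intro integrable_mult_of_squares H_measurable H_square_integrable)

text \<open>Resampling coordinate \<open>i\<close> preserves the law and leaves \<open>H L\<close>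
  alone. Integrating the resampled coordinate first replaces \<open>H J\<close> by its average over
  \<open>i\<close>, which is zero almost everywhere.\<close>

lemma H_orthogonal_aux:
  assumes "J \<subseteq> I" "L \<subseteq> I" "i \<in> J" "i \<notin> L"
  shows "(\<integral>x. H L x * H J x \<partial>Pi\<^sub>M I M) = 0"
proof -
  note [measurable] = H_measurable[OF assms(1)] H_measurable[OF assms(2)]
  have "(\<integral>x. H L x * H J x \<partial>Pi\<^sub>M I M) =
      (\<integral>z. H L (override_on (fst z) (snd z) {i}) * H J (override_on (fst z) (snd z) {i})
        \<partial>(Pi\<^sub>M I M \<Otimes>\<^sub>M Pi\<^sub>M I M))"
    by (subst integral_override_on) simp_all
  also have "\<dots> = (\<integral>z. H L (fst z) * H J (override_on (fst z) (snd z) {i}) \<partial>(Pi\<^sub>M I M \<Otimes>\<^sub>M Pi\<^sub>M I M))"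
  proof (rule Bochner_Integration.integral_cong)
    fix z assume "z \<in> space (Pi\<^sub>M I M \<Otimes>\<^sub>M Pi\<^sub>M I M)"
    then have "H L (override_on (fst z) (snd z) {i}) = H L (fst z)"
      using assms by (intro H_local override_on_in_space)
        (auto simp: override_on_def space_pair_measure)
    then show "H L (override_on (fst z) (snd z) {i}) * H J (override_on (fst z) (snd z) {i}) =
        H L (fst z) * H J (override_on (fst z) (snd z) {i})" by simp
  qed simp
  also have "\<dots> = (\<integral>x. H L x * ave {i} (H J) x \<partial>Pi\<^sub>M I M)"
    using assms by (intro integral_mult_ave H_square_integrable) simp_all
  also have "\<dots> = 0"
    using H_degenerate[OF assms(1,3)] by (intro integral_eq_zero_AE) auto
  finally show ?thesis .
qed

section \<open>Energies of the kernels and Parseval's identity\<close>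

definition energy :: "nat set \<Rightarrow> real" where
  "energy J = (\<integral>x. (H J x)\<^sup>2 \<partial>Pi\<^sub>M I M)"

lemma energy_nonneg: "0 \<le> energy J"
  by (simp add: energy_def)

lemma H_orthogonal:
  assumes "J \<subseteq> I" "L \<subseteq> I"
  shows "(\<integral>x. H J x * H L x \<partial>Pi\<^sub>M I M) = (if J = L then energy J else 0)"
proof (cases "J = L")
  case False
  then obtain i where "i \<in> J \<and> i \<notin> L \<or> i \<in> L \<and> i \<notin> J" by blast
  then show ?thesis
    using H_orthogonal_aux[of J L i] H_orthogonal_aux[of L J i] assms False
    by (auto simp: mult.commute)
qed (simp add: energy_def power2_eq_square)

text \<open>By orthogonality only the diagonal of the double sum survives. Because the families are
  nested, that diagonal is exactly the smaller one; this form serves both for squares and for the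
  correlation of \<open>f\<close> with its averages.\<close>

lemma integral_sum_H_mult:
  assumes "\<J> \<subseteq> Pow I" "\<L> \<subseteq> \<J>"
  shows "(\<integral>x. (\<Sum>J\<in>\<J>. H J x) * (\<Sum>L\<in>\<L>. H L x) \<partial>Pi\<^sub>M I M) = (\<Sum>L\<in>\<L>. energy L)"
proof -
  have fin: "finite \<J>" "finite \<L>"
    using assms finite_index by (meson finite_Pow_iff finite_subset)+
  have "(\<integral>x. (\<Sum>J\<in>\<J>. H J x) * (\<Sum>L\<in>\<L>. H L x) \<partial>Pi\<^sub>M I M) =
      (\<integral>x. (\<Sum>L\<in>\<L>. \<Sum>J\<in>\<J>. H J x * H L x) \<partial>Pi\<^sub>M I M)"
    by (simp add: sum_product sum.swap[of _ \<J>])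
  also have "\<dots> = (\<Sum>L\<in>\<L>. \<Sum>J\<in>\<J>. \<integral>x. H J x * H L x \<partial>Pi\<^sub>M I M)"
    using assms by (subst Bochner_Integration.integral_sum)
      (auto intro!: Bochner_Integration.integral_sum sum.cong Bochner_Integration.integrable_sum
        integrable_H_mult)
  also have "\<dots> = (\<Sum>L\<in>\<L>. \<Sum>J\<in>\<J>. if J = L then energy J else 0)"
    using assms by (intro sum.cong refl H_orthogonal) auto
  also have "\<dots> = (\<Sum>L\<in>\<L>. energy L)"
    using assms fin by (intro sum.cong) auto
  finally show ?thesis .
qed

lemma sum_H_square:
  assumes "\<J> \<subseteq> Pow I"
  shows "integrable (Pi\<^sub>M I M) (\<lambda>x. (\<Sum>J\<in>\<J>. H J x)\<^sup>2)"
    and "(\<integral>x. (\<Sum>J\<in>\<J>. H J x)\<^sup>2 \<partial>Pi\<^sub>M I M) = (\<Sum>J\<in>\<J>. energy J)"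
proof -
  have "finite \<J>"
    using assms finite_index by (meson finite_Pow_iff finite_subset)
  then show "integrable (Pi\<^sub>M I M) (\<lambda>x. (\<Sum>J\<in>\<J>. H J x)\<^sup>2)"
    using assms by (intro integrable_square_sum H_measurable H_square_integrable) auto
  show "(\<integral>x. (\<Sum>J\<in>\<J>. H J x)\<^sup>2 \<partial>Pi\<^sub>M I M) = (\<Sum>J\<in>\<J>. energy J)"
    using integral_sum_H_mult[OF assms subset_refl] by (simp add: power2_eq_square)
qed

lemma AE_sum_H_eq_0_iff:
  assumes "\<J> \<subseteq> Pow I"
  shows "(AE x in Pi\<^sub>M I M. (\<Sum>J\<in>\<J>. H J x) = 0) \<longleftrightarrow> (\<forall>J\<in>\<J>. energy J = 0)"
proof -
  have "finite \<J>"
    using assms finite_index by (meson finite_Pow_iff finite_subset)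
  then have "(\<forall>J\<in>\<J>. energy J = 0) \<longleftrightarrow> (\<Sum>J\<in>\<J>. energy J) = 0"
    by (simp add: sum_nonneg_eq_0_iff energy_nonneg)
  also have "\<dots> \<longleftrightarrow> (AE x in Pi\<^sub>M I M. (\<Sum>J\<in>\<J>. H J x)\<^sup>2 = 0)"
    using integral_nonneg_eq_0_iff_AE[OF sum_H_square(1)[OF assms]] sum_H_square(2)[OF assms]
    by simp
  finally show ?thesis by simp
qed

text \<open>This will be the squared \<open>L2\<close> norm of the iterated difference of
  \<open>f\<close> over \<open>A\<close>.\<close>

definition upper :: "nat set \<Rightarrow> real" where
  "upper A = (\<Sum>J | J \<subseteq> I \<and> A \<subseteq> J. energy J)"

text \<open>The counterpart of \<open>frakD\<close> with \<open>ave\<close> instead of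
  \<open>pexp\<close>.\<close>

definition diffs :: "nat list \<Rightarrow> (nat \<Rightarrow> 'a) \<Rightarrow> real" where
  "diffs is = foldr (\<lambda>i g x. g x - ave {i} g x) is f"

lemma diffs_measurable [measurable]: "diffs is \<in> borel_measurable (Pi\<^sub>M I M)"
proof (induction "is")
  case (Cons i "is")
  have "diffs (i # is) = (\<lambda>x. diffs is x - ave {i} (diffs is) x)"
    by (simp add: diffs_def)
  then show ?case using Cons by simp
qed (simp add: diffs_def)

text \<open>Averaging over \<open>{i}\<close> retains precisely the kernels with
  \<open>i \<notin> J\<close>, so subtracting the average leaves precisely those with
  \<open>i \<in> J\<close>.\<close>

lemma AE_diffs: "AE x in Pi\<^sub>M I M. diffs is x = (\<Sum>J | J \<subseteq> I \<and> set is \<subseteq> J. H J x)"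
proof (induction "is")
  case Nil
  show ?case using f_decomp by (simp add: diffs_def Pow_def)
next
  case (Cons i "is")
  let ?J = "{J. J \<subseteq> I \<and> set is \<subseteq> J}"
  have fin: "finite ?J" using finite_index by simp
  have "AE x in Pi\<^sub>M I M. ave {i} (diffs is) x = (\<Sum>J | J \<in> ?J \<and> J \<inter> {i} = {}. H J x)"
    by (rule AE_ave_sum_H) (use Cons in auto)
  with Cons show ?case
  proof eventually_elim
    case (elim x)
    have "(\<Sum>J\<in>?J. H J x) = (\<Sum>J | J \<in> ?J \<and> i \<in> J. H J x) + (\<Sum>J | J \<in> ?J \<and> i \<notin> J. H J x)"
      by (subst sum.union_disjoint[symmetric])
        (auto intro!: sum.cong intro: finite_subset[OF _ fin])
    moreover have "{J. J \<in> ?J \<and> i \<in> J} = {J. J \<subseteq> I \<and> set (i # is) \<subseteq> J}" by auto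
    ultimately show ?case
      using elim by (simp add: diffs_def)
  qed
qed

lemma diffs_square:
  shows "integrable (Pi\<^sub>M I M) (\<lambda>x. (diffs is x)\<^sup>2)"
    and "(\<integral>x. (diffs is x)\<^sup>2 \<partial>Pi\<^sub>M I M) = upper (set is)"
proof -
  let ?J = "{J. J \<subseteq> I \<and> set is \<subseteq> J}"
  have J: "?J \<subseteq> Pow I" by auto
  have [measurable]: "(\<lambda>x. \<Sum>J\<in>?J. H J x) \<in> borel_measurable (Pi\<^sub>M I M)"
    by (intro borel_measurable_sum H_measurable) auto
  have *: "AE x in Pi\<^sub>M I M. (diffs is x)\<^sup>2 = (\<Sum>J\<in>?J. H J x)\<^sup>2"
    using AE_diffs[of "is"] by (auto elim!: eventually_mono)
  show "integrable (Pi\<^sub>M I M) (\<lambda>x. (diffs is x)\<^sup>2)"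
    by (subst integrable_cong_AE[OF _ _ *]) (auto simp: sum_H_square[OF J])
  show "(\<integral>x. (diffs is x)\<^sup>2 \<partial>Pi\<^sub>M I M) = upper (set is)"
    by (subst integral_cong_AE[OF _ _ *]) (auto simp: sum_H_square[OF J] upper_def)
qed

end

subsection \<open>Resampling differences\<close>

text \<open>The intersection is counted twice on the right, which does not affect parity.\<close>

lemma minus_one_power_card_sym_diff:
  assumes "finite K" "finite L"
  shows "(- 1 :: real) ^ card (sym_diff K L) = (- 1) ^ card K * (- 1) ^ card L"
proof -
  have K: "card K = card (K - L) + card (K \<inter> L)" and L: "card L = card (L - K) + card (K \<inter> L)"
    using assms by (simp_all add: card_Diff_subset_Int card_mono Int_commute)
  have "card (sym_diff K L) = card (K - L) + card (L - K)"
    using assms by (intro card_Un_disjoint) auto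
  then show ?thesis
    by (simp add: K L power_add power_mult_distrib[symmetric] algebra_simps)
qed

text \<open>For fixed \<open>K\<close>, the map \<open>sym_diff K\<close> is an involution of
  \<open>Pow A\<close>.\<close>

lemma sum_Pow_sym_diff:
  assumes "K \<subseteq> A"
  shows "(\<Sum>L\<in>Pow A. g (sym_diff K L)) = (\<Sum>L\<in>Pow A. g L)"
  by (rule sum.reindex_bij_witness[of _ "sym_diff K" "sym_diff K"]) (use assms in auto)

text \<open>Inclusion-exclusion: the left side is the expansion of the product over
  \<open>x \<in> A\<close> of \<open>1 - of_bool (x \<notin> J)\<close>, whose factors indicate
  \<open>x \<in> J\<close>.\<close>

lemma sum_Pow_minus_one_disjoint:
  assumes "finite A"
  shows "(\<Sum>S\<in>Pow A. (- 1 :: real) ^ card S * of_bool (J \<inter> S = {})) = of_bool (A \<subseteq> J)"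
proof -
  have S: "(\<Prod>x\<in>S. of_bool (x \<notin> J)) = (of_bool (J \<inter> S = {}) :: real)" if "S \<subseteq> A" for S
  proof -
    have "finite S" using assms that finite_subset by blast
    then show ?thesis by (auto simp: of_bool_def intro!: prod.neutral prod_zero)
  qed
  have "(\<Sum>S\<in>Pow A. (- 1 :: real) ^ card S * of_bool (J \<inter> S = {})) =
      (\<Sum>S\<in>Pow A. (- 1) ^ card S * (\<Prod>x\<in>S. of_bool (x \<notin> J)) * (\<Prod>x\<in>A - S. 1))"
    by (intro sum.cong refl) (simp add: S)
  also have "\<dots> = (\<Prod>x\<in>A. 1 - of_bool (x \<notin> J))"
    by (rule prod_diff_conv_sum[OF assms, symmetric])
  also have "\<dots> = of_bool (A \<subseteq> J)"
    using assms by (auto simp: of_bool_def intro!: prod.neutral prod_zero)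
  finally show ?thesis .
qed

text \<open>Expanding the product of the operators \<open>Id - T_i\<close>, the set \<open>K\<close>
  collects the indices for which \<open>T_i\<close> was chosen. The induction sorts the sets by
  whether they contain the outermost index.\<close>

lemma resample_diff_eq_sum:
  assumes "distinct is"
  shows "resample_diff f is x y = (\<Sum>K\<in>Pow (set is). (- 1) ^ card K * f (override_on x y K))"
  using assms
proof (induction "is" arbitrary: x)
  case Nil
  then show ?case by (simp add: resample_diff_def)
next
  case (Cons i "is")
  let ?g = "\<lambda>K. (- 1) ^ card K * f (override_on x y K)"
  have "resample_diff f (i # is) x y = resample_diff f is x y - resample_diff f is (x(i := y i)) y"
    by (simp add: resample_diff_def resample_def)
  also have "resample_diff f is (x(i := y i)) y = (\<Sum>K\<in>Pow (set is). - ?g (insert i K))"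
  proof -
    \<comment> \<open>Distinctness gives \<open>i \<notin> K\<close>, so inserting \<open>i\<close>
      raises the cardinality by one and flips the sign.\<close>
    have *: "(- 1) ^ card K * f (override_on (x(i := y i)) y K) = - ?g (insert i K)" if "K \<in> Pow (set is)" for K
    proof -
      have "finite K" "i \<notin> K"
        using that Cons.prems finite_subset by auto
      then show ?thesis by (simp only: override_on_insert' card_insert_disjoint power_Suc) simp
    qed
    have "resample_diff f is (x(i := y i)) y =
        (\<Sum>K\<in>Pow (set is). (- 1) ^ card K * f (override_on (x(i := y i)) y K))"
      using Cons by simp
    also have "\<dots> = (\<Sum>K\<in>Pow (set is). - ?g (insert i K))"
      by (intro sum.cong refl *)
    finally show ?thesis .
  qed
  also have "\<dots> = - (\<Sum>K\<in>insert i ` Pow (set is). ?g K)"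
    using Cons.prems by (subst sum.reindex) (auto simp: sum_negf inj_on_def)
  also have "resample_diff f is x y - \<dots> = (\<Sum>K\<in>Pow (set (i # is)). ?g K)"
  proof -
    have "Pow (set is) \<inter> insert i ` Pow (set is) = {}"
      using Cons.prems by auto
    then have "(\<Sum>K\<in>Pow (set (i # is)). ?g K) =
        (\<Sum>K\<in>Pow (set is). ?g K) + (\<Sum>K\<in>insert i ` Pow (set is). ?g K)"
      by (simp only: list.simps Pow_insert) (rule sum.union_disjoint; simp)
    moreover have "resample_diff f is x y = (\<Sum>K\<in>Pow (set is). ?g K)"
      using Cons by simp
    ultimately show ?thesis by linarith
  qed
  finally show ?case .
qed

lemma resample_diff_cong:
  assumes "\<And>i. i \<in> set is \<Longrightarrow> y i = y' i"
  shows "resample_diff f is x y = resample_diff f is x y'"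
  using assms by (induction "is" arbitrary: x) (auto simp: resample_diff_def resample_def)

section \<open>Correlations of partially resampled versions of \<open>f\<close>\<close>

context finite_product_prob_space
begin

text \<open>After both operations a coordinate comes from the copy exactly if one of
  \<open>K\<close> and \<open>L\<close>, but not both, contains it.\<close>

lemma override_on_swap_on:
  "override_on (fst (swap_on K z)) (snd (swap_on K z)) L = override_on (fst z) (snd z) (sym_diff K L)"
  by (auto simp: swap_on_def override_on_def fun_eq_iff)

end

context hoeffding_kernels
begin

interpretation PP: pair_prob_space "Pi\<^sub>M I M" "Pi\<^sub>M I M" ..

text \<open>Integrating out the copy turns the second factor into \<open>ave K f\<close>, which
  consists of the kernels that avoid \<open>K\<close>; Parseval then gives their energies.\<close>

lemma integral_f_mult_override_on:
  "(\<integral>z. f (fst z) * f (override_on (fst z) (snd z) K) \<partial>(Pi\<^sub>M I M \<Otimes>\<^sub>M Pi\<^sub>M I M)) =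
    (\<Sum>J\<in>Pow (I - K). energy J)"
proof -
  have m [measurable]: "(\<lambda>x. \<Sum>J\<in>\<J>. H J x) \<in> borel_measurable (Pi\<^sub>M I M)" if "\<J> \<subseteq> Pow I" for \<J>
    using that by (intro borel_measurable_sum H_measurable) auto
  have "(\<integral>z. f (fst z) * f (override_on (fst z) (snd z) K) \<partial>(Pi\<^sub>M I M \<Otimes>\<^sub>M Pi\<^sub>M I M)) =
      (\<integral>x. f x * ave K f x \<partial>Pi\<^sub>M I M)"
    by (intro integral_mult_ave f_square f_measurable)
  also have "\<dots> = (\<integral>x. (\<Sum>J\<in>Pow I. H J x) * (\<Sum>J\<in>Pow (I - K). H J x) \<partial>Pi\<^sub>M I M)"
  proof (rule integral_cong_AE)
    show "AE x in Pi\<^sub>M I M. f x * ave K f x = (\<Sum>J\<in>Pow I. H J x) * (\<Sum>J\<in>Pow (I - K). H J x)"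
      using f_decomp AE_ave_f[of K] by eventually_elim simp
  qed (auto intro!: borel_measurable_times m)
  also have "\<dots> = (\<Sum>J\<in>Pow (I - K). energy J)"
    by (intro integral_sum_H_mult) auto
  finally show ?thesis .
qed

text \<open>Swapping the coordinates in \<open>K\<close> preserves the joint law and reduces the
  pair \<open>K\<close>, \<open>L\<close> to the pair \<open>{}\<close>,
  \<open>sym_diff K L\<close>.\<close>

lemma integral_override_on_mult:
  "(\<integral>z. f (override_on (fst z) (snd z) K) * f (override_on (fst z) (snd z) L)
      \<partial>(Pi\<^sub>M I M \<Otimes>\<^sub>M Pi\<^sub>M I M)) = (\<Sum>J\<in>Pow (I - sym_diff K L). energy J)"
proof -
  let ?G = "\<lambda>z. f (fst z) * f (override_on (fst z) (snd z) (sym_diff K L))"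
  have "sym_diff K (sym_diff K L) = L" by auto
  then have "?G (swap_on K z) = f (override_on (fst z) (snd z) K) * f (override_on (fst z) (snd z) L)" for z
    using override_on_swap_on[of K z "sym_diff K L"] by (simp add: swap_on_def)
  then show ?thesis
    using integral_swap_on[of ?G K] by (simp add: integral_f_mult_override_on)
qed

lemma resample_diff_measurable:
  assumes "distinct is"
  shows "(\<lambda>z. resample_diff f is (fst z) (snd z)) \<in> borel_measurable (Pi\<^sub>M I M \<Otimes>\<^sub>M Pi\<^sub>M I M)"
  unfolding resample_diff_eq_sum[OF assms] by measurable

lemma integrable_resample_diff_square:
  assumes "distinct is"
  shows "integrable (Pi\<^sub>M I M \<Otimes>\<^sub>M Pi\<^sub>M I M) (\<lambda>z. (resample_diff f is (fst z) (snd z))\<^sup>2)"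
  unfolding resample_diff_eq_sum[OF assms]
  using integrable_override_on[OF f_square]
  by (intro integrable_square_sum) (auto simp: power_mult_distrib)

text \<open>The square is a signed double sum of correlations, each depending on
  \<open>sym_diff K L\<close> only. Re-indexing makes the inner sum independent of \<open>K\<close>,
  and inclusion-exclusion singles out the kernels with \<open>set is \<subseteq> J\<close>.\<close>

lemma integral_resample_diff_square:
  assumes "distinct is" "set is \<subseteq> I"
  shows "(\<integral>z. (resample_diff f is (fst z) (snd z))\<^sup>2 \<partial>(Pi\<^sub>M I M \<Otimes>\<^sub>M Pi\<^sub>M I M)) =
    2 ^ length is * upper (set is)"
proof -
  let ?A = "set is" and ?P2 = "Pi\<^sub>M I M \<Otimes>\<^sub>M Pi\<^sub>M I M"
  let ?f = "\<lambda>K z. f (override_on (fst z) (snd z) K)"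
  let ?t = "\<lambda>S. (- 1) ^ card S * (\<Sum>J\<in>Pow (I - S). energy J)"
  have fin: "finite S" if "S \<in> Pow ?A" for S
    using that finite_subset by auto
  have int: "integrable ?P2 (\<lambda>z. (- 1) ^ card K * (- 1) ^ card L * (?f K z * ?f L z))" for K L
    using integrable_override_on[OF f_square]
    by (intro integrable_mult_right integrable_mult_of_squares) auto
  have "(\<integral>z. (resample_diff f is (fst z) (snd z))\<^sup>2 \<partial>?P2) =
      (\<integral>z. (\<Sum>K\<in>Pow ?A. \<Sum>L\<in>Pow ?A. (- 1) ^ card K * (- 1) ^ card L * (?f K z * ?f L z)) \<partial>?P2)"
    by (simp add: resample_diff_eq_sum[OF assms(1)] power2_eq_square sum_product mult_ac)
  also have "\<dots> = (\<Sum>K\<in>Pow ?A. \<Sum>L\<in>Pow ?A. \<integral>z. (- 1) ^ card K * (- 1) ^ card L * (?f K z * ?f L z) \<partial>?P2)"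
    by (subst Bochner_Integration.integral_sum, intro Bochner_Integration.integrable_sum int)
      (intro sum.cong refl Bochner_Integration.integral_sum int)
  also have "\<dots> = (\<Sum>K\<in>Pow ?A. \<Sum>L\<in>Pow ?A. ?t (sym_diff K L))"
    by (intro sum.cong refl) (simp add: integral_override_on_mult minus_one_power_card_sym_diff fin)
  also have "\<dots> = (\<Sum>K\<in>Pow ?A. \<Sum>S\<in>Pow ?A. ?t S)"
    by (intro sum.cong refl sum_Pow_sym_diff) auto
  \<comment> \<open>The factor is the number of sets \<open>K\<close>; by distinctness
    \<open>?A\<close> has \<open>length is\<close> elements.\<close>
  also have "\<dots> = 2 ^ length is * (\<Sum>S\<in>Pow ?A. ?t S)"
    by (simp add: card_Pow distinct_card assms)
  also have "(\<Sum>S\<in>Pow ?A. ?t S) =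
      (\<Sum>S\<in>Pow ?A. \<Sum>J\<in>Pow I. energy J * ((- 1) ^ card S * of_bool (J \<inter> S = {})))"
  proof (rule sum.cong[OF refl])
    fix S
    have "(\<Sum>J\<in>Pow (I - S). energy J) = (\<Sum>J\<in>Pow I. energy J * of_bool (J \<inter> S = {}))"
      using finite_index by (intro sum.mono_neutral_cong_left) auto
    then show "?t S = (\<Sum>J\<in>Pow I. energy J * ((- 1) ^ card S * of_bool (J \<inter> S = {})))"
      by (simp add: sum_distrib_left mult_ac)
  qed
  also have "\<dots> = (\<Sum>J\<in>Pow I. energy J * of_bool (?A \<subseteq> J))"
    by (subst sum.swap) (simp add: sum_distrib_left[symmetric] sum_Pow_minus_one_disjoint del: sum_mult_of_bool_eq)
  also have "\<dots> = upper ?A"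
    unfolding upper_def using finite_index by (intro sum.mono_neutral_cong_right) auto
  finally show ?thesis .
qed

text \<open>The swap turns the term for \<open>K\<close> into the one for
  \<open>sym_diff {i} K\<close>, whose sign is opposite, and this only permutes the terms of the
  expansion.\<close>

lemma resample_diff_swap_on:
  assumes "distinct is" "i \<in> set is"
  shows "resample_diff f is (fst (swap_on {i} z)) (snd (swap_on {i} z)) =
    - resample_diff f is (fst z) (snd z)"
proof -
  let ?g = "\<lambda>K. (- 1) ^ card K * f (override_on (fst z) (snd z) K)"
  have fin: "finite S" if "S \<in> Pow (set is)" for S
    using that finite_subset by auto
  have "resample_diff f is (fst (swap_on {i} z)) (snd (swap_on {i} z)) =
      (\<Sum>K\<in>Pow (set is). - ?g (sym_diff {i} K))"
    unfolding resample_diff_eq_sum[OF assms(1)]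
  proof (intro sum.cong refl)
    fix K assume "K \<in> Pow (set is)"
    from minus_one_power_card_sym_diff[OF _ fin[OF this], of "{i}"]
    show "(- 1) ^ card K * f (override_on (fst (swap_on {i} z)) (snd (swap_on {i} z)) K) =
        - ?g (sym_diff {i} K)"
      by (simp add: override_on_swap_on)
  qed
  also have "\<dots> = - (\<Sum>K\<in>Pow (set is). ?g K)"
    using assms sum_Pow_sym_diff[of "{i}" "set is" ?g] by (simp add: sum_negf)
  finally show ?thesis
    by (simp add: resample_diff_eq_sum[OF assms(1)])
qed

text \<open>Swapping one coordinate preserves the law and interchanges positive and negative part,
  so the two mean squares agree; together they make up the full square. Nonemptiness of the list
  supplies the coordinate to swap.\<close>

lemma
  assumes "distinct is" "set is \<subseteq> I" "is \<noteq> []"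
  shows integral_resample_diff_pos_square:
      "(\<integral>z. (max (resample_diff f is (fst z) (snd z)) 0)\<^sup>2 \<partial>(Pi\<^sub>M I M \<Otimes>\<^sub>M Pi\<^sub>M I M)) =
        2 ^ length is * upper (set is) / 2" (is "?pos = _")
    and integral_resample_diff_neg_square:
      "(\<integral>z. (max (- resample_diff f is (fst z) (snd z)) 0)\<^sup>2 \<partial>(Pi\<^sub>M I M \<Otimes>\<^sub>M Pi\<^sub>M I M)) =
        2 ^ length is * upper (set is) / 2" (is "?neg = _")
proof -
  let ?P2 = "Pi\<^sub>M I M \<Otimes>\<^sub>M Pi\<^sub>M I M" and ?R = "\<lambda>z. resample_diff f is (fst z) (snd z)"
  note [measurable] = resample_diff_measurable[OF assms(1)]
  obtain i where i: "i \<in> set is" using assms(3) by (cases "is") auto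
  have eq: "?neg = ?pos"
    using integral_swap_on[of "\<lambda>z. (max (?R z) 0)\<^sup>2" "{i}"] i
    by (simp add: resample_diff_swap_on assms)
  have int: "integrable ?P2 (\<lambda>z. (max (?R z) 0)\<^sup>2)" "integrable ?P2 (\<lambda>z. (max (- ?R z) 0)\<^sup>2)"
    by (rule Bochner_Integration.integrable_bound[OF integrable_resample_diff_square[OF assms(1)]];
        simp add: max_def)+
  have "?pos + ?neg = (\<integral>z. (max (?R z) 0)\<^sup>2 + (max (- ?R z) 0)\<^sup>2 \<partial>?P2)"
    using int by simp
  also have "\<dots> = (\<integral>z. (?R z)\<^sup>2 \<partial>?P2)"
    by (rule Bochner_Integration.integral_cong) (auto simp: max_def)
  finally show "?pos = 2 ^ length is * upper (set is) / 2" "?neg = 2 ^ length is * upper (set is) / 2"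
    using eq integral_resample_diff_square[OF assms(1,2)] by simp_all
qed

end

subsection \<open>Mean squares of the difference hypermatrices\<close>

text \<open>In Pascal's rule both summands are positive. This strictness decides the equality
  case.\<close>

lemma one_less_binomial:
  assumes "1 \<le> k" "k < n"
  shows "1 < n choose k"
proof -
  obtain m l where "n = Suc m" "k = Suc l" "l < m"
    using assms by (cases n; cases k) auto
  moreover from this have "0 < m choose l" "0 < m choose Suc l"
    by (intro zero_less_binomial; simp)+
  then have "1 < (m choose l) + (m choose Suc l)" by linarith
  ultimately show ?thesis
    by simp
qed

lemma hs_norm_hypermatrix_square:
  "(hs_norm n d (hypermatrix n a x))\<^sup>2 =
    (\<Sum>is | length is = d \<and> set is \<subseteq> {1..n} \<and> distinct is. (a is x)\<^sup>2)"
proof -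
  let ?L = "{is. length is = d \<and> set is \<subseteq> {1..n}}"
  have fin: "finite ?L"
    using finite_lists_length_eq[of "{1..n}" d] by (simp add: conj_commute)
  have "(hs_norm n d (hypermatrix n a x))\<^sup>2 = (\<Sum>is\<in>?L. (hypermatrix n a x is)\<^sup>2)"
    by (simp add: hs_norm_def L2_set_def sum_nonneg)
  also have "\<dots> = (\<Sum>is | length is = d \<and> set is \<subseteq> {1..n} \<and> distinct is. (a is x)\<^sup>2)"
    using fin by (intro sum.mono_neutral_cong_right) (auto simp: hypermatrix_def)
  finally show ?thesis .
qed

text \<open>Each set of size \<open>d\<close> is enumerated by \<open>d!\<close> lists; this is the
  factor that \<open>1 / d!\<close> in the bounds compensates.\<close>

lemma sum_distinct_lists:
  fixes g :: "'b set \<Rightarrow> real"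
  assumes "finite I"
  shows "(\<Sum>is | length is = d \<and> set is \<subseteq> I \<and> distinct is. g (set is)) =
    fact d * (\<Sum>A | A \<subseteq> I \<and> card A = d. g A)"
proof -
  let ?\<A> = "{A. A \<subseteq> I \<and> card A = d}"
  have fin: "finite A" if "A \<in> ?\<A>" for A
    using that assms finite_subset by blast
  have "{is. length is = d \<and> set is \<subseteq> I \<and> distinct is} = (\<Union>A\<in>?\<A>. permutations_of_set A)"
    by (auto simp: permutations_of_set_def distinct_card)
  then have "(\<Sum>is | length is = d \<and> set is \<subseteq> I \<and> distinct is. g (set is)) =
      (\<Sum>A\<in>?\<A>. \<Sum>is\<in>permutations_of_set A. g (set is))"
  proof (simp only:, intro sum.UNION_disjoint ballI impI)
    show "finite ?\<A>" using assms by simp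
    show "permutations_of_set A \<inter> permutations_of_set B = {}" if "A \<noteq> B" for A B :: "'b set"
      using that by (auto dest: permutations_of_setD(1))
  qed simp
  also have "\<dots> = (\<Sum>A\<in>?\<A>. fact d * g A)"
  proof (rule sum.cong[OF refl])
    fix A assume A: "A \<in> ?\<A>"
    have "(\<Sum>is\<in>permutations_of_set A. g (set is)) = (\<Sum>is\<in>permutations_of_set A. g A)"
      by (rule sum.cong) (auto simp: permutations_of_set_def)
    then show "(\<Sum>is\<in>permutations_of_set A. g (set is)) = fact d * g A"
      using A fin[OF A] by simp
  qed
  finally show ?thesis
    by (simp add: sum_distrib_left)
qed

lemma sum_subsets_by_card:
  assumes "finite I"
  shows "(\<Sum>k=a..card I. \<Sum>J | J \<subseteq> I \<and> card J = k. g J) = (\<Sum>J | J \<subseteq> I \<and> a \<le> card J. g J)"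
proof -
  have *: "card J \<le> card I" if "J \<subseteq> I" for J
    using that assms by (rule card_mono[rotated])
  have "(\<Sum>J | J \<subseteq> I \<and> a \<le> card J. g J) = (\<Sum>k=a..card I. \<Sum>J | J \<in> {J. J \<subseteq> I \<and> a \<le> card J} \<and> card J = k. g J)"
    using assms * by (intro sum.group[symmetric]) auto
  also have "\<dots> = (\<Sum>k=a..card I. \<Sum>J | J \<subseteq> I \<and> card J = k. g J)"
    by (intro sum.cong) auto
  finally show ?thesis by simp
qed

section \<open>Partial expectations as averages over the full product\<close>

context finite_product_prob_space
begin

lemma measurable_override_on_sub:
  assumes "K \<subseteq> I" "L \<subseteq> K" "x \<in> space (Pi\<^sub>M I M)"
  shows "(\<lambda>y. override_on x y L) \<in> measurable (Pi\<^sub>M K M) (Pi\<^sub>M I M)"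
  unfolding override_on_def
proof (rule measurable_PiM_single')
  show "(\<lambda>y. if i \<in> L then y i else x i) \<in> measurable (Pi\<^sub>M K M) (M i)" if "i \<in> I" for i
    using that assms measurable_component_singleton[of i K M]
    by (cases "i \<in> L") (auto simp: space_PiM PiE_iff)
  show "(\<lambda>y i. if i \<in> L then y i else x i) \<in> space (Pi\<^sub>M K M) \<rightarrow> (\<Pi>\<^sub>E i\<in>I. space (M i))"
    using assms by (fastforce simp: space_PiM PiE_iff extensional_def)
qed

lemma integral_PiM_sub:
  fixes G :: "('a \<Rightarrow> 'b) \<Rightarrow> real"
  assumes "K \<subseteq> I" "G \<in> borel_measurable (Pi\<^sub>M K M)"
  shows "(\<integral>y. G y \<partial>Pi\<^sub>M K M) = (\<integral>y. G (restrict y K) \<partial>Pi\<^sub>M I M)"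
  by (subst distr_restrict[OF assms(1) finite_index], rule integral_distr)
    (use assms in \<open>auto intro: measurable_restrict_subset\<close>)

end

context
  fixes M :: "nat \<Rightarrow> 'a measure" and I :: "nat set"
  assumes fpps: "finite_product_prob_space M I"
begin

interpretation finite_product_prob_space M I by (rule fpps)

text \<open>The marginal of the full product on \<open>K\<close> is the product over
  \<open>K\<close>. Agreement of \<open>g\<close> and \<open>G\<close> is asked for on the space
  only, as that is all an induction over iterated differences provides.\<close>

lemma pexp_eq_ave:
  assumes "K \<subseteq> I" "x \<in> space (Pi\<^sub>M I M)"
    and "G \<in> borel_measurable (Pi\<^sub>M I M)" "\<And>x. x \<in> space (Pi\<^sub>M I M) \<Longrightarrow> g x = G x"
  shows "pexp M K g x = ave K G x"
proof -
  note m = measurable_override_on_sub[OF assms(1) subset_refl assms(2)]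
  have "pexp M K g x = (\<integral>y. G (override_on x y K) \<partial>Pi\<^sub>M K M)"
    unfolding pexp_def
    by (rule Bochner_Integration.integral_cong) (simp_all add: assms(4) measurable_space[OF m])
  also have "\<dots> = (\<integral>y. G (override_on x (restrict y K) K) \<partial>Pi\<^sub>M I M)"
    by (intro integral_PiM_sub[OF assms(1)] measurable_compose[OF m assms(3)])
  also have "\<dots> = ave K G x"
    unfolding ave_def by (intro arg_cong[where f="integral\<^sup>L _"]) (auto simp: override_on_def fun_eq_iff cong: if_cong)
  finally show ?thesis .
qed

end

context hoeffding_kernels
begin

interpretation PP: pair_prob_space "Pi\<^sub>M I M" "Pi\<^sub>M I M" ..

lemma frakD_eq_diffs:
  assumes "set is \<subseteq> I" "x \<in> space (Pi\<^sub>M I M)"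
  shows "frakD M f is x = diffs is x"
  using assms
proof (induction "is" arbitrary: x)
  case (Cons i "is")
  have "pexp M {i} (frakD M f is) x = ave {i} (diffs is) x"
    by (rule pexp_eq_ave[OF finite_product_prob_space_axioms]) (use Cons in auto)
  then show ?case
    using Cons by (simp add: frakD_def diffs_def)
qed (simp add: frakD_def diffs_def)

lemma frakv_square:
  assumes "set is \<subseteq> I" "x \<in> space (Pi\<^sub>M I M)"
  shows "(frakv M f is x)\<^sup>2 = ave (set is) (\<lambda>x. (diffs is x)\<^sup>2) x"
proof -
  have "pexp M (set is) (\<lambda>x'. (frakD M f is x')\<^sup>2) x = ave (set is) (\<lambda>x. (diffs is x)\<^sup>2) x"
    by (rule pexp_eq_ave[OF finite_product_prob_space_axioms])
      (use assms frakD_eq_diffs in auto)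
  moreover have "0 \<le> ave (set is) (\<lambda>x. (diffs is x)\<^sup>2) x"
    by (simp add: ave_def)
  ultimately show ?thesis
    by (simp add: frakv_def)
qed

lemma integral_resample_diff_PiM:
  assumes "distinct is" "set is \<subseteq> I" "x \<in> space (Pi\<^sub>M I M)" and [measurable]: "\<phi> \<in> borel_measurable borel"
  shows "(\<integral>y. (\<phi> (resample_diff f is x y) :: real) \<partial>Pi\<^sub>M (set is) M) = (\<integral>y. \<phi> (resample_diff f is x y) \<partial>Pi\<^sub>M I M)"
proof -
  have "(\<lambda>y. f (override_on x y K)) \<in> borel_measurable (Pi\<^sub>M (set is) M)" if "K \<in> Pow (set is)" for K
    using measurable_compose[OF measurable_override_on_sub[OF assms(2) _ assms(3)] f_measurable] that
    by auto
  then have "(\<lambda>y. resample_diff f is x y) \<in> borel_measurable (Pi\<^sub>M (set is) M)"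
    unfolding resample_diff_eq_sum[OF assms(1)]
    by (intro borel_measurable_sum borel_measurable_times borel_measurable_const)
  then have "(\<integral>y. \<phi> (resample_diff f is x y) \<partial>Pi\<^sub>M (set is) M) =
      (\<integral>y. \<phi> (resample_diff f is x (restrict y (set is))) \<partial>Pi\<^sub>M I M)"
    by (intro integral_PiM_sub[OF assms(2)] measurable_compose[OF _ assms(4)])
  also have "(\<lambda>y. resample_diff f is x (restrict y (set is))) = resample_diff f is x"
    by (intro ext resample_diff_cong) simp
  finally show ?thesis .
qed

text \<open>One treatment of the three choices of \<open>\<phi>\<close>: the square, and the squares
  of the positive and the negative part. Domination by the square gives integrability on the pair
  space, and Fubini does the rest.\<close>

lemma integral_resample_mean:
  fixes \<phi> :: "real \<Rightarrow> real"
  assumes "distinct is" "set is \<subseteq> I"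
    and [measurable]: "\<phi> \<in> borel_measurable borel" and \<phi>: "\<And>t. 0 \<le> \<phi> t" "\<And>t. \<phi> t \<le> t\<^sup>2"
  defines "a \<equiv> \<lambda>x. sqrt (1 / 2 ^ length is * (\<integral>y. \<phi> (resample_diff f is x y) \<partial>Pi\<^sub>M (set is) M))"
  shows "integrable (Pi\<^sub>M I M) (\<lambda>x. (a x)\<^sup>2)"
    and "(\<integral>x. (a x)\<^sup>2 \<partial>Pi\<^sub>M I M) = 1 / 2 ^ length is *
      (\<integral>z. \<phi> (resample_diff f is (fst z) (snd z)) \<partial>(Pi\<^sub>M I M \<Otimes>\<^sub>M Pi\<^sub>M I M))"
proof -
  note [measurable] = resample_diff_measurable[OF assms(1)]
  have int: "integrable (Pi\<^sub>M I M \<Otimes>\<^sub>M Pi\<^sub>M I M) (\<lambda>z. \<phi> (resample_diff f is (fst z) (snd z)))"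
    by (rule Bochner_Integration.integrable_bound[OF integrable_resample_diff_square[OF assms(1)]])
      (use \<phi> in auto)
  have a: "(a x)\<^sup>2 = 1 / 2 ^ length is * (\<integral>y. \<phi> (resample_diff f is x y) \<partial>Pi\<^sub>M I M)"
    if "x \<in> space (Pi\<^sub>M I M)" for x
    unfolding a_def by (subst integral_resample_diff_PiM[OF assms(1,2) that assms(3)])
      (simp add: \<phi> Bochner_Integration.integral_nonneg)
  show "integrable (Pi\<^sub>M I M) (\<lambda>x. (a x)\<^sup>2)"
    using PP.integrable_fst'[OF int] by (simp add: a cong: Bochner_Integration.integrable_cong)
  show "(\<integral>x. (a x)\<^sup>2 \<partial>Pi\<^sub>M I M) = 1 / 2 ^ length is *
      (\<integral>z. \<phi> (resample_diff f is (fst z) (snd z)) \<partial>(Pi\<^sub>M I M \<Otimes>\<^sub>M Pi\<^sub>M I M))"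
    using PP.integral_fst'[OF int] by (simp add: a cong: Bochner_Integration.integral_cong)
qed

text \<open>The common value of all five bounds: \<open>J\<close> is counted once for each of its
  subsets of size \<open>d\<close>.\<close>

definition binomial_energy :: "nat \<Rightarrow> real" where
  "binomial_energy d = (\<Sum>J\<in>Pow I. real (card J choose d) * energy J)"

lemma sum_upper: "(\<Sum>A | A \<subseteq> I \<and> card A = d. upper A) = binomial_energy d"
proof -
  have "(\<Sum>A | A \<subseteq> I \<and> card A = d. upper A) =
      (\<Sum>A\<in>{A. A \<subseteq> I \<and> card A = d}. \<Sum>J | J \<in> Pow I \<and> A \<subseteq> J. energy J)"
    by (simp add: upper_def)
  also have "\<dots> = (\<Sum>J\<in>Pow I. \<Sum>A | A \<in> {A. A \<subseteq> I \<and> card A = d} \<and> A \<subseteq> J. energy J)"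
    using finite_index by (intro sum.swap_restrict) auto
  also have "\<dots> = binomial_energy d"
    unfolding binomial_energy_def
  proof (rule sum.cong[OF refl])
    fix J assume J: "J \<in> Pow I"
    then have "{A. A \<in> {A. A \<subseteq> I \<and> card A = d} \<and> A \<subseteq> J} = {A. A \<subseteq> J \<and> card A = d}"
      by auto
    moreover have "finite J" using J finite_index finite_subset by blast
    ultimately show "(\<Sum>A | A \<in> {A. A \<subseteq> I \<and> card A = d} \<and> A \<subseteq> J. energy J) = real (card J choose d) * energy J"
      by (simp add: n_subsets)
  qed
  finally show ?thesis .
qed

text \<open>The constant \<open>C\<close> is \<open>1\<close> for the full differences and
  \<open>1 / 2\<close> for their positive and negative parts.\<close>

lemma integral_hs_norm_square:
  assumes "I = {1..n}"
    and "\<And>is. length is = d \<Longrightarrow> set is \<subseteq> I \<Longrightarrow> distinct is \<Longrightarrow> integrable (Pi\<^sub>M I M) (\<lambda>x. (a is x)\<^sup>2)"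
    and "\<And>is. length is = d \<Longrightarrow> set is \<subseteq> I \<Longrightarrow> distinct is \<Longrightarrow>
      (\<integral>x. (a is x)\<^sup>2 \<partial>Pi\<^sub>M I M) = C * upper (set is)"
  shows "integrable (Pi\<^sub>M I M) (\<lambda>x. (hs_norm n d (hypermatrix n a x))\<^sup>2)" (is ?int)
    and "(\<integral>x. (hs_norm n d (hypermatrix n a x))\<^sup>2 \<partial>Pi\<^sub>M I M) = fact d * C * binomial_energy d" (is ?eq)
proof -
  let ?L = "{is. length is = d \<and> set is \<subseteq> I \<and> distinct is}"
  show ?int
    unfolding hs_norm_hypermatrix_square using assms by (intro Bochner_Integration.integrable_sum) auto
  have "(\<integral>x. (hs_norm n d (hypermatrix n a x))\<^sup>2 \<partial>Pi\<^sub>M I M) = (\<Sum>is\<in>?L. C * upper (set is))"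
    unfolding hs_norm_hypermatrix_square assms(1)[symmetric]
    using assms(2,3) by (subst Bochner_Integration.integral_sum) auto
  also have "\<dots> = fact d * C * binomial_energy d"
    using sum_distinct_lists[OF finite_index, where d=d and g=upper]
    by (simp add: sum_distrib_left[symmetric] sum_upper)
  finally show ?eq .
qed

lemma
  assumes "I = {1..n}"
  shows frakD_mean_square:
      "integrable (Pi\<^sub>M I M) (\<lambda>x. (hs_norm n d (hypermatrix n (frakD M f) x))\<^sup>2)"
      "(\<integral>x. (hs_norm n d (hypermatrix n (frakD M f) x))\<^sup>2 \<partial>Pi\<^sub>M I M) = fact d * binomial_energy d"
    and frakv_mean_square:
      "integrable (Pi\<^sub>M I M) (\<lambda>x. (hs_norm n d (hypermatrix n (frakv M f) x))\<^sup>2)"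
      "(\<integral>x. (hs_norm n d (hypermatrix n (frakv M f) x))\<^sup>2 \<partial>Pi\<^sub>M I M) = fact d * binomial_energy d"
    and frakd_mean_square:
      "integrable (Pi\<^sub>M I M) (\<lambda>x. (hs_norm n d (hypermatrix n (frakd M f) x))\<^sup>2)"
      "(\<integral>x. (hs_norm n d (hypermatrix n (frakd M f) x))\<^sup>2 \<partial>Pi\<^sub>M I M) = fact d * binomial_energy d"
proof -
  have D: "integrable (Pi\<^sub>M I M) (\<lambda>x. (frakD M f is x)\<^sup>2)"
    "(\<integral>x. (frakD M f is x)\<^sup>2 \<partial>Pi\<^sub>M I M) = 1 * upper (set is)" if "set is \<subseteq> I" for "is"
    using diffs_square[of "is"] that
    by (simp_all add: frakD_eq_diffs cong: Bochner_Integration.integrable_cong Bochner_Integration.integral_cong)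
  show "integrable (Pi\<^sub>M I M) (\<lambda>x. (hs_norm n d (hypermatrix n (frakD M f) x))\<^sup>2)"
    "(\<integral>x. (hs_norm n d (hypermatrix n (frakD M f) x))\<^sup>2 \<partial>Pi\<^sub>M I M) = fact d * binomial_energy d"
    using integral_hs_norm_square[OF assms, of d "frakD M f" 1, OF D] by simp_all
  have v: "integrable (Pi\<^sub>M I M) (\<lambda>x. (frakv M f is x)\<^sup>2)"
    "(\<integral>x. (frakv M f is x)\<^sup>2 \<partial>Pi\<^sub>M I M) = 1 * upper (set is)" if "set is \<subseteq> I" for "is"
    \<comment> \<open>The square of \<open>frakv\<close> is an average of the squared difference,
      and averaging does not change the mean.\<close>
    using integrable_ave[OF diffs_square(1)[of "is"]] integral_ave[OF diffs_square(1)[of "is"]]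
      diffs_square(2)[of "is"] that
    by (simp_all add: frakv_square cong: Bochner_Integration.integrable_cong Bochner_Integration.integral_cong)
  show "integrable (Pi\<^sub>M I M) (\<lambda>x. (hs_norm n d (hypermatrix n (frakv M f) x))\<^sup>2)"
    "(\<integral>x. (hs_norm n d (hypermatrix n (frakv M f) x))\<^sup>2 \<partial>Pi\<^sub>M I M) = fact d * binomial_energy d"
    using integral_hs_norm_square[OF assms, of d "frakv M f" 1, OF v] by simp_all
  have d: "integrable (Pi\<^sub>M I M) (\<lambda>x. (frakd M f is x)\<^sup>2)"
    "(\<integral>x. (frakd M f is x)\<^sup>2 \<partial>Pi\<^sub>M I M) = 1 * upper (set is)" if "set is \<subseteq> I" "distinct is" for "is"
    unfolding frakd_def using integral_resample_mean[OF that(2,1), of "\<lambda>t. t\<^sup>2"]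
      integral_resample_diff_square[OF that(2,1)] by simp_all
  show "integrable (Pi\<^sub>M I M) (\<lambda>x. (hs_norm n d (hypermatrix n (frakd M f) x))\<^sup>2)"
    "(\<integral>x. (hs_norm n d (hypermatrix n (frakd M f) x))\<^sup>2 \<partial>Pi\<^sub>M I M) = fact d * binomial_energy d"
    using integral_hs_norm_square[OF assms, of d "frakd M f" 1, OF d] by simp_all
qed

text \<open>Half the energy per entry is what the constant \<open>2\<close> in these bounds makes up
  for. With \<open>1 \<le> d\<close> every tuple has a coordinate to swap.\<close>

lemma
  assumes "I = {1..n}" "1 \<le> d"
  shows frakd_plus_mean_square:
      "integrable (Pi\<^sub>M I M) (\<lambda>x. (hs_norm n d (hypermatrix n (frakd_plus M f) x))\<^sup>2)"
      "(\<integral>x. (hs_norm n d (hypermatrix n (frakd_plus M f) x))\<^sup>2 \<partial>Pi\<^sub>M I M) = fact d / 2 * binomial_energy d"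
    and frakd_minus_mean_square:
      "integrable (Pi\<^sub>M I M) (\<lambda>x. (hs_norm n d (hypermatrix n (frakd_minus M f) x))\<^sup>2)"
      "(\<integral>x. (hs_norm n d (hypermatrix n (frakd_minus M f) x))\<^sup>2 \<partial>Pi\<^sub>M I M) = fact d / 2 * binomial_energy d"
proof -
  have \<phi>: "(max t 0)\<^sup>2 \<le> t\<^sup>2" "(max (- t) 0)\<^sup>2 \<le> t\<^sup>2" for t :: real
    by (auto simp: max_def)
  have p: "integrable (Pi\<^sub>M I M) (\<lambda>x. (frakd_plus M f is x)\<^sup>2)"
    "(\<integral>x. (frakd_plus M f is x)\<^sup>2 \<partial>Pi\<^sub>M I M) = 1 / 2 * upper (set is)"
    if "length is = d" "set is \<subseteq> I" "distinct is" for "is"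
  proof -
    have ne: "is \<noteq> []" using that(1) assms(2) by auto
    have \<phi>': "(\<lambda>t :: real. (max t 0)\<^sup>2) \<in> borel_measurable borel" by measurable
    note mean = integral_resample_mean[OF that(3,2) \<phi>' zero_le_power2 \<phi>(1)]
    show "integrable (Pi\<^sub>M I M) (\<lambda>x. (frakd_plus M f is x)\<^sup>2)"
      unfolding frakd_plus_def by (rule mean(1))
    show "(\<integral>x. (frakd_plus M f is x)\<^sup>2 \<partial>Pi\<^sub>M I M) = 1 / 2 * upper (set is)"
      unfolding frakd_plus_def mean(2) integral_resample_diff_pos_square[OF that(3,2) ne] by simp
  qed
  show "integrable (Pi\<^sub>M I M) (\<lambda>x. (hs_norm n d (hypermatrix n (frakd_plus M f) x))\<^sup>2)"
    "(\<integral>x. (hs_norm n d (hypermatrix n (frakd_plus M f) x))\<^sup>2 \<partial>Pi\<^sub>M I M) = fact d / 2 * binomial_energy d"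
    using integral_hs_norm_square[OF assms(1), of d "frakd_plus M f" "1 / 2", OF p] by simp_all
  have m: "integrable (Pi\<^sub>M I M) (\<lambda>x. (frakd_minus M f is x)\<^sup>2)"
    "(\<integral>x. (frakd_minus M f is x)\<^sup>2 \<partial>Pi\<^sub>M I M) = 1 / 2 * upper (set is)"
    if "length is = d" "set is \<subseteq> I" "distinct is" for "is"
  proof -
    have ne: "is \<noteq> []" using that(1) assms(2) by auto
    have \<phi>': "(\<lambda>t :: real. (max (- t) 0)\<^sup>2) \<in> borel_measurable borel" by measurable
    note mean = integral_resample_mean[OF that(3,2) \<phi>' zero_le_power2 \<phi>(2)]
    show "integrable (Pi\<^sub>M I M) (\<lambda>x. (frakd_minus M f is x)\<^sup>2)"
      unfolding frakd_minus_def by (rule mean(1))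
    show "(\<integral>x. (frakd_minus M f is x)\<^sup>2 \<partial>Pi\<^sub>M I M) = 1 / 2 * upper (set is)"
      unfolding frakd_minus_def mean(2) integral_resample_diff_neg_square[OF that(3,2) ne] by simp
  qed
  show "integrable (Pi\<^sub>M I M) (\<lambda>x. (hs_norm n d (hypermatrix n (frakd_minus M f) x))\<^sup>2)"
    "(\<integral>x. (hs_norm n d (hypermatrix n (frakd_minus M f) x))\<^sup>2 \<partial>Pi\<^sub>M I M) = fact d / 2 * binomial_energy d"
    using integral_hs_norm_square[OF assms(1), of d "frakd_minus M f" "1 / 2", OF m] by simp_all
qed

text \<open>The gap between the two sides is a sum over \<open>J\<close> of
  \<open>card J choose d\<close> minus one, times the energy. The weight is zero for
  \<open>card J = d\<close> and positive above, so the gap vanishes exactly if all kernels of order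
  above \<open>d\<close> do.\<close>

lemma
  assumes "1 \<le> d"
    and f: "AE x in Pi\<^sub>M I M. f x = m + (\<Sum>J | J \<subseteq> I \<and> d \<le> card J. H J x)"
  shows variance_le_binomial_energy: "(\<integral>x. (f x - m)\<^sup>2 \<partial>Pi\<^sub>M I M) \<le> binomial_energy d" (is "?V \<le> _")
    and variance_eq_binomial_energy_iff: "(\<integral>x. (f x - m)\<^sup>2 \<partial>Pi\<^sub>M I M) = binomial_energy d \<longleftrightarrow>
      (AE x in Pi\<^sub>M I M. f x = m + (\<Sum>J | J \<subseteq> I \<and> card J = d. H J x))"
proof -
  let ?U = "{J. J \<subseteq> I \<and> d \<le> card J}" and ?E = "{J. J \<subseteq> I \<and> card J = d}"
    and ?G = "{J. J \<subseteq> I \<and> d < card J}"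
  have fin: "finite ?U" "finite ?E" "finite ?G"
    using finite_index by simp_all
  have U: "?U = ?E \<union> ?G" "?E \<inter> ?G = {}" by auto
  have [measurable]: "(\<lambda>x. \<Sum>J\<in>?U. H J x) \<in> borel_measurable (Pi\<^sub>M I M)"
    by (intro borel_measurable_sum H_measurable) auto
  have "?V = (\<integral>x. (\<Sum>J\<in>?U. H J x)\<^sup>2 \<partial>Pi\<^sub>M I M)"
    using f by (intro integral_cong_AE) (auto elim!: eventually_mono)
  also have "\<dots> = (\<Sum>J\<in>?U. energy J)"
    by (rule sum_H_square) auto
  finally have V: "?V = (\<Sum>J\<in>?U. energy J)" .
  \<comment> \<open>Sets with fewer than \<open>d\<close> elements drop out because their binomial
    coefficient is zero.\<close>
  have W: "binomial_energy d = (\<Sum>J\<in>?U. real (card J choose d) * energy J)"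
    unfolding binomial_energy_def using finite_index
    by (intro sum.mono_neutral_right) (auto simp: binomial_eq_0)
  have "binomial_energy d - ?V = (\<Sum>J\<in>?U. (real (card J choose d) - 1) * energy J)"
    unfolding V W by (simp add: sum_subtractf[symmetric] algebra_simps)
  also have "\<dots> = (\<Sum>J\<in>?G. (real (card J choose d) - 1) * energy J)"
    using fin by (subst U) (subst sum.union_disjoint; auto)
  finally have diff: "binomial_energy d - ?V = (\<Sum>J\<in>?G. (real (card J choose d) - 1) * energy J)" .
  have pos: "0 < real (card J choose d) - 1" if "J \<in> ?G" for J
    using one_less_binomial[OF assms(1), of "card J"] that by simp
  have nonneg: "0 \<le> (real (card J choose d) - 1) * energy J" if "J \<in> ?G" for J
    using pos[OF that] energy_nonneg[of J] by simp
  show "?V \<le> binomial_energy d"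
  proof -
    have "0 \<le> (\<Sum>J\<in>?G. (real (card J choose d) - 1) * energy J)"
      by (rule sum_nonneg) (rule nonneg)
    with diff show ?thesis by simp
  qed
  have "?V = binomial_energy d \<longleftrightarrow> (\<Sum>J\<in>?G. (real (card J choose d) - 1) * energy J) = 0"
    using diff by auto
  also have "\<dots> \<longleftrightarrow> (\<forall>J\<in>?G. (real (card J choose d) - 1) * energy J = 0)"
    by (rule sum_nonneg_eq_0_iff[OF fin(3) nonneg])
  also have "\<dots> \<longleftrightarrow> (\<forall>J\<in>?G. energy J = 0)"
  proof (rule ball_cong[OF refl])
    fix J assume "J \<in> ?G"
    from pos[OF this] show "(real (card J choose d) - 1) * energy J = 0 \<longleftrightarrow> energy J = 0" by simp
  qed
  also have "\<dots> \<longleftrightarrow> (AE x in Pi\<^sub>M I M. (\<Sum>J\<in>?G. H J x) = 0)"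
    by (rule AE_sum_H_eq_0_iff[symmetric]) auto
  also have "\<dots> \<longleftrightarrow> (AE x in Pi\<^sub>M I M. f x = m + (\<Sum>J\<in>?E. H J x))"
  proof -
    \<comment> \<open>Almost every point satisfies the hypothesis on \<open>f\<close>, and at such a
      point the two equations are equivalent.\<close>
    have "AE x in Pi\<^sub>M I M. (\<Sum>J\<in>?G. H J x) = 0 \<longleftrightarrow> f x = m + (\<Sum>J\<in>?E. H J x)"
      using f
    proof eventually_elim
      case (elim x)
      have "(\<Sum>J\<in>?U. H J x) = (\<Sum>J\<in>?E. H J x) + (\<Sum>J\<in>?G. H J x)"
        using fin U(2) by (subst U(1), intro sum.union_disjoint)
      with elim show ?case by simp
    qed
    then show ?thesis
      by (rule eventually_subst)
  qed
  finally show "?V = binomial_energy d \<longleftrightarrow> (AE x in Pi\<^sub>M I M. f x = m + (\<Sum>J\<in>?E. H J x))" .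
qed

end

subsection \<open>Transfer to the law of the random vector\<close>

lemma pexp_cong_measures:
  assumes "\<And>i. i \<in> K \<Longrightarrow> \<mu> i = \<nu> i"
  shows "pexp \<mu> K g = pexp \<nu> K g"
  using PiM_cong[OF refl assms, of K] by (simp add: pexp_def fun_eq_iff)

lemma frakD_cong_measures:
  assumes "\<And>i. i \<in> set is \<Longrightarrow> \<mu> i = \<nu> i"
  shows "frakD \<mu> f is = frakD \<nu> f is"
  using assms
proof (induction "is")
  case (Cons i "is")
  then have "frakD \<mu> f is = frakD \<nu> f is" by simp
  moreover have "pexp \<mu> {i} g = pexp \<nu> {i} g" for g
    by (rule pexp_cong_measures) (use Cons.prems in auto)
  ultimately show ?case by (simp add: frakD_def)
qed (simp add: frakD_def)

lemma frakv_cong_measures: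
  assumes "\<And>i. i \<in> set is \<Longrightarrow> \<mu> i = \<nu> i"
  shows "frakv \<mu> f is = frakv \<nu> f is"
  using frakD_cong_measures[OF assms] pexp_cong_measures[of "set is" \<mu> \<nu>] assms
  by (simp add: frakv_def fun_eq_iff)

lemma frakd_cong_measures:
  assumes "\<And>i. i \<in> set is \<Longrightarrow> \<mu> i = \<nu> i"
  shows "frakd \<mu> f is = frakd \<nu> f is" "frakd_plus \<mu> f is = frakd_plus \<nu> f is"
    "frakd_minus \<mu> f is = frakd_minus \<nu> f is"
  using PiM_cong[OF refl assms, of "set is"]
  by (simp_all add: frakd_def frakd_plus_def frakd_minus_def fun_eq_iff)

lemma hypermatrix_cong:
  assumes "\<And>is. set is \<subseteq> {1..n} \<Longrightarrow> a is = b is"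
  shows "hypermatrix n a = hypermatrix n b"
  using assms by (simp add: hypermatrix_def fun_eq_iff)

declare One_nat_def [simp del]

locale independent_hoeffding = prob_space M for M :: "'w measure" +
  fixes N :: "nat \<Rightarrow> 'a measure" and X :: "nat \<Rightarrow> 'w \<Rightarrow> 'a" and n :: nat
    and f :: "(nat \<Rightarrow> 'a) \<Rightarrow> real" and h :: "nat set \<Rightarrow> (nat \<Rightarrow> 'a) \<Rightarrow> real"
  assumes indep: "indep_vars N X {1..n}" and n_pos: "1 \<le> n"
    and f_meas: "f \<in> borel_measurable (PiM {1..n} N)"
    and f_sq: "integrable M (\<lambda>\<omega>. (f (subvec X {1..n} \<omega>))\<^sup>2)"
    and decomp: "hoeffding_decomposition M N X n f h"
begin

abbreviation S :: "'w \<Rightarrow> nat \<Rightarrow> 'a" where "S \<equiv> subvec X {1..n}"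

definition m :: real where "m = expectation (\<lambda>\<omega>. f (S \<omega>))"

text \<open>Outside \<open>{1..n}\<close> nothing is known about \<open>X i\<close>; any probability measure serves there.\<close>

definition \<mu> :: "nat \<Rightarrow> 'a measure" where
  "\<mu> i = (if i \<in> {1..n} then law M N X i else return (count_space UNIV) undefined)"

text \<open>The notion of decomposition leaves \<open>h {}\<close> unconstrained, so the mean is put
  in its place. Restriction lifts each kernel to the full product.\<close>

definition H :: "nat set \<Rightarrow> (nat \<Rightarrow> 'a) \<Rightarrow> real" where
  "H J x = (if J = {} then m else h J (restrict x J))"

lemma X_measurable: "i \<in> {1..n} \<Longrightarrow> X i \<in> measurable M (N i)"
  using indep by (simp add: indep_vars_def)

lemma prob_space_\<mu>: "prob_space (\<mu> i)"
  using X_measurable[of i]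
  by (auto simp: \<mu>_def law_def intro: prob_space_distr prob_space_return)

lemma finite_product_prob_space_\<mu>: "finite_product_prob_space \<mu> {1..n}"
proof -
  interpret \<mu>: prob_space "\<mu> i" for i by (rule prob_space_\<mu>)
  show ?thesis by unfold_locales simp
qed

sublocale Q: finite_product_prob_space \<mu> "{1..n}"
  by (rule finite_product_prob_space_\<mu>)

lemma sets_\<mu>: "J \<subseteq> {1..n} \<Longrightarrow> sets (PiM J \<mu>) = sets (PiM J N)"
  by (rule sets_PiM_cong) (auto simp: \<mu>_def law_def)

lemma S_measurable: "S \<in> measurable M (PiM {1..n} \<mu>)"
proof -
  have "S \<in> measurable M (PiM {1..n} N)"
    unfolding subvec_def by (rule measurable_restrict) (rule X_measurable)
  then show ?thesis
    by (simp only: measurable_cong_sets[OF refl sets_\<mu>[OF subset_refl]])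
qed

text \<open>Independence in the form that the joint law is the product of the marginals; that
  characterisation wants a nonempty index set, whence \<open>n_pos\<close>.\<close>

lemma distr_S: "distr M (PiM {1..n} \<mu>) S = PiM {1..n} \<mu>"
proof -
  have "distr M (PiM {1..n} \<mu>) S = distr M (PiM {1..n} N) (\<lambda>\<omega>. \<lambda>i\<in>{1..n}. X i \<omega>)"
    by (rule distr_cong[OF refl sets_\<mu>[OF subset_refl]]) (simp add: subvec_def)
  also have "\<dots> = PiM {1..n} (\<lambda>i. distr M (N i) (X i))"
    using indep_vars_iff_distr_eq_PiM'[of "{1..n}" X N] indep X_measurable n_pos by auto
  also have "\<dots> = PiM {1..n} \<mu>"
    by (rule PiM_cong) (auto simp: \<mu>_def law_def)
  finally show ?thesis .
qed

lemma integral_S: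
  fixes g :: "(nat \<Rightarrow> 'a) \<Rightarrow> real"
  assumes "g \<in> borel_measurable (PiM {1..n} \<mu>)"
  shows "(\<integral>\<omega>. g (S \<omega>) \<partial>M) = (\<integral>x. g x \<partial>PiM {1..n} \<mu>)"
  using integral_distr[OF S_measurable assms] by (simp add: distr_S)

lemma integrable_S:
  fixes g :: "(nat \<Rightarrow> 'a) \<Rightarrow> real"
  assumes "g \<in> borel_measurable (PiM {1..n} \<mu>)"
  shows "integrable M (\<lambda>\<omega>. g (S \<omega>)) \<longleftrightarrow> integrable (PiM {1..n} \<mu>) g"
  using integrable_distr_eq[OF S_measurable assms] by (simp add: distr_S)

lemma AE_S:
  fixes g k :: "(nat \<Rightarrow> 'a) \<Rightarrow> real"
  assumes [measurable]: "g \<in> borel_measurable (PiM {1..n} \<mu>)" "k \<in> borel_measurable (PiM {1..n} \<mu>)"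
  shows "(AE \<omega> in M. g (S \<omega>) = k (S \<omega>)) \<longleftrightarrow> (AE x in PiM {1..n} \<mu>. g x = k x)"
proof -
  have "(AE x in distr M (PiM {1..n} \<mu>) S. g x = k x) \<longleftrightarrow> (AE \<omega> in M. g (S \<omega>) = k (S \<omega>))"
    by (rule AE_distr_iff[OF S_measurable]) simp
  then show ?thesis by (subst (asm) distr_S) simp
qed

lemma h_facts:
  assumes "J \<subseteq> {1..n}" "J \<noteq> {}"
  shows "h J \<in> borel_measurable (PiM J N)" "integrable M (\<lambda>\<omega>. h J (subvec X J \<omega>))"
    "\<And>i. i \<in> J \<Longrightarrow> AE \<omega> in M. pexp (law M N X) {i} (h J) (subvec X J \<omega>) = 0"
  using decomp assms unfolding hoeffding_decomposition_def by blast+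

lemma restrict_S: "J \<subseteq> {1..n} \<Longrightarrow> restrict (S \<omega>) J = subvec X J \<omega>"
  by (auto simp: subvec_def fun_eq_iff)

lemma H_meas:
  assumes "J \<subseteq> {1..n}"
  shows "H J \<in> borel_measurable (PiM {1..n} \<mu>)"
proof (cases "J = {}")
  case False
  have "h J \<in> borel_measurable (PiM J \<mu>)"
    using h_facts(1)[OF assms False] by (simp only: measurable_cong_sets[OF sets_\<mu>[OF assms] refl])
  from measurable_compose[OF measurable_restrict_subset[OF assms] this] False
  show ?thesis by (simp add: H_def[abs_def])
qed (simp add: H_def[abs_def])

lemma H_S: "J \<subseteq> {1..n} \<Longrightarrow> J \<noteq> {} \<Longrightarrow> H J (S \<omega>) = h J (subvec X J \<omega>)"
  by (simp add: H_def restrict_S)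

lemma hoeffding_term_eq:
  "hoeffding_term M X n f h k \<omega> = (\<Sum>J | J \<subseteq> {1..n} \<and> card J = k. H J (S \<omega>))"
proof (cases "k = 0")
  case True
  \<comment> \<open>Finiteness matters, as infinite sets have cardinality zero too. The order zero
    term thus becomes \<open>H {}\<close>, the mean.\<close>
  have "{J. J \<subseteq> {1..n} \<and> card J = 0} = {{}}"
    by (auto dest: finite_subset[OF _ finite_atLeastAtMost])
  then show ?thesis
    using True by (simp add: hoeffding_term_def H_def m_def)
next
  case False
  then have "J \<noteq> {}" if "card J = k" for J :: "nat set"
    using that by auto
  then show ?thesis
    using False by (auto simp: hoeffding_term_def H_S intro!: sum.cong)
qed

lemma sum_hoeffding_terms:
  "(\<Sum>k=a..n. hoeffding_term M X n f h k \<omega>) = (\<Sum>J | J \<subseteq> {1..n} \<and> a \<le> card J. H J (S \<omega>))"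
  using sum_subsets_by_card[of "{1..n}" "\<lambda>J. H J (S \<omega>)" a] by (simp add: hoeffding_term_eq)

lemma sum_H_meas:
  assumes "\<J> \<subseteq> Pow {1..n}"
  shows "(\<lambda>x. \<Sum>J\<in>\<J>. H J x) \<in> borel_measurable (PiM {1..n} \<mu>)"
  using assms by (intro borel_measurable_sum H_meas) auto

lemma f_meas_\<mu>: "f \<in> borel_measurable (PiM {1..n} \<mu>)"
  using f_meas by (simp only: measurable_cong_sets[OF sets_\<mu>[OF subset_refl] refl])

text \<open>Degeneracy is given along the subvector in the coordinates \<open>J\<close>; at almost
  every outcome it is the same statement about the lifted kernel at the full vector, which then
  passes to the law.\<close>

lemma AE_ave_H_eq_0:
  assumes "J \<subseteq> {1..n}" "i \<in> J"
  shows "AE x in PiM {1..n} \<mu>. Q.ave {i} (H J) x = 0"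
proof -
  have ne: "J \<noteq> {}" and i: "{i} \<subseteq> {1..n}" using assms by auto
  have "pexp (law M N X) {i} (h J) (subvec X J \<omega>) = Q.ave {i} (H J) (S \<omega>)" if "\<omega> \<in> space M" for \<omega>
  proof -
    have "restrict (override_on (S \<omega>) y {i}) J = override_on (subvec X J \<omega>) y {i}" for y
      using assms by (auto simp: subvec_def override_on_def fun_eq_iff)
    then have "pexp (law M N X) {i} (h J) (subvec X J \<omega>) = pexp (law M N X) {i} (H J) (S \<omega>)"
      using ne by (simp add: pexp_def H_def)
    also have "\<dots> = pexp \<mu> {i} (H J) (S \<omega>)"
      using i pexp_cong_measures[of "{i}" \<mu> "law M N X" "H J"] by (simp add: \<mu>_def)
    also have "\<dots> = Q.ave {i} (H J) (S \<omega>)"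
      using measurable_space[OF S_measurable that] H_meas[OF assms(1)]
      by (intro pexp_eq_ave[OF finite_product_prob_space_\<mu> i]) auto
    finally show ?thesis .
  qed
  with h_facts(3)[OF assms(1) ne assms(2)]
  have "AE \<omega> in M. Q.ave {i} (H J) (S \<omega>) = 0"
    by (auto elim!: AE_mp)
  then show ?thesis
    using AE_S[of "Q.ave {i} (H J)" "\<lambda>_. 0"] Q.measurable_ave[OF H_meas[OF assms(1)]] by simp
qed

sublocale K: hoeffding_kernels \<mu> "{1..n}" f H
proof
  show "f \<in> borel_measurable (PiM {1..n} \<mu>)" by (rule f_meas_\<mu>)
  then show "integrable (PiM {1..n} \<mu>) (\<lambda>x. (f x)\<^sup>2)"
    using integrable_S[of "\<lambda>x. (f x)\<^sup>2"] f_sq by simp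
  show "integrable (PiM {1..n} \<mu>) (H J)" if "J \<subseteq> {1..n}" for J
  proof (cases "J = {}")
    case False
    then show ?thesis
      using integrable_S[OF H_meas[OF that]] h_facts(2)[OF that False] by (simp add: H_S[OF that False])
  qed (simp add: H_def[abs_def])
  show "H J x = H J y" if "\<And>i. i \<in> J \<Longrightarrow> x i = y i" for J x y
  proof -
    have "restrict x J = restrict y J" using that by (auto simp: fun_eq_iff)
    then show ?thesis by (simp add: H_def)
  qed
  show "AE x in PiM {1..n} \<mu>. Q.ave {i} (H J) x = 0" if "J \<subseteq> {1..n}" "i \<in> J" for J i
    by (rule AE_ave_H_eq_0[OF that])
  have "AE \<omega> in M. f (S \<omega>) = (\<Sum>k=0..n. hoeffding_term M X n f h k \<omega>)"
    using decomp by (simp add: hoeffding_decomposition_def)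
  then have "AE \<omega> in M. f (S \<omega>) = (\<Sum>J\<in>Pow {1..n}. H J (S \<omega>))"
    by (simp only: sum_hoeffding_terms le0 simp_thms Pow_def)
  then show "AE x in PiM {1..n} \<mu>. f x = (\<Sum>J\<in>Pow {1..n}. H J x)"
    using AE_S[OF f_meas_\<mu> sum_H_meas] by simp
qed

text \<open>Hypermatrix entries vanish outside \<open>{1..n}\<close>, so agreement on tuples from
  \<open>{1..n}\<close> suffices. This allows passing from \<open>law M N X\<close> to
  \<open>\<mu>\<close>, which coincide on these indices.\<close>

lemma mean_sq_norm_eq:
  assumes "\<And>is. set is \<subseteq> {1..n} \<Longrightarrow> a is = b is"
    and "integrable (PiM {1..n} \<mu>) (\<lambda>x. (hs_norm n d (hypermatrix n b x))\<^sup>2)"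
  shows "mean_sq_norm M X n d a = (\<integral>x. (hs_norm n d (hypermatrix n b x))\<^sup>2 \<partial>PiM {1..n} \<mu>)"
proof -
  have "hypermatrix n a = hypermatrix n b"
    by (rule hypermatrix_cong) (rule assms(1))
  then show ?thesis
    unfolding mean_sq_norm_def by (simp only:) (rule integral_S, use assms(2) in auto)
qed

lemma mean_sq_norms:
  shows "mean_sq_norm M X n d (frakv (law M N X) f) = fact d * K.binomial_energy d"
    and "mean_sq_norm M X n d (frakD (law M N X) f) = fact d * K.binomial_energy d"
    and "mean_sq_norm M X n d (frakd (law M N X) f) = fact d * K.binomial_energy d"
    and "1 \<le> d \<Longrightarrow> mean_sq_norm M X n d (frakd_plus (law M N X) f) = fact d / 2 * K.binomial_energy d"
    and "1 \<le> d \<Longrightarrow> mean_sq_norm M X n d (frakd_minus (law M N X) f) = fact d / 2 * K.binomial_energy d"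
proof -
  have cong: "frakv (law M N X) f is = frakv \<mu> f is" "frakD (law M N X) f is = frakD \<mu> f is"
    "frakd (law M N X) f is = frakd \<mu> f is" "frakd_plus (law M N X) f is = frakd_plus \<mu> f is"
    "frakd_minus (law M N X) f is = frakd_minus \<mu> f is" if "set is \<subseteq> {1..n}" for "is"
  proof -
    have \<mu>: "law M N X i = \<mu> i" if "i \<in> set is" for i
      using that \<open>set is \<subseteq> {1..n}\<close> by (auto simp: \<mu>_def)
    show "frakv (law M N X) f is = frakv \<mu> f is" "frakD (law M N X) f is = frakD \<mu> f is"
      "frakd (law M N X) f is = frakd \<mu> f is" "frakd_plus (law M N X) f is = frakd_plus \<mu> f is"
      "frakd_minus (law M N X) f is = frakd_minus \<mu> f is"
      by (intro frakv_cong_measures frakD_cong_measures frakd_cong_measures \<mu>; assumption)+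
  qed
  show "mean_sq_norm M X n d (frakv (law M N X) f) = fact d * K.binomial_energy d"
    using mean_sq_norm_eq[OF cong(1) K.frakv_mean_square(1)[OF refl]] K.frakv_mean_square(2)[OF refl]
    by simp
  show "mean_sq_norm M X n d (frakD (law M N X) f) = fact d * K.binomial_energy d"
    using mean_sq_norm_eq[OF cong(2) K.frakD_mean_square(1)[OF refl]] K.frakD_mean_square(2)[OF refl]
    by simp
  show "mean_sq_norm M X n d (frakd (law M N X) f) = fact d * K.binomial_energy d"
    using mean_sq_norm_eq[OF cong(3) K.frakd_mean_square(1)[OF refl]] K.frakd_mean_square(2)[OF refl]
    by simp
  show "mean_sq_norm M X n d (frakd_plus (law M N X) f) = fact d / 2 * K.binomial_energy d" if "1 \<le> d"
    using mean_sq_norm_eq[OF cong(4) K.frakd_plus_mean_square(1)[OF refl that]]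
      K.frakd_plus_mean_square(2)[OF refl that] by simp
  show "mean_sq_norm M X n d (frakd_minus (law M N X) f) = fact d / 2 * K.binomial_energy d" if "1 \<le> d"
    using mean_sq_norm_eq[OF cong(5) K.frakd_minus_mean_square(1)[OF refl that]]
      K.frakd_minus_mean_square(2)[OF refl that] by simp
qed

lemma
  assumes "1 \<le> d"
    and f: "AE \<omega> in M. f (S \<omega>) = m + (\<Sum>k=d..n. hoeffding_term M X n f h k \<omega>)"
  shows variance_le: "variance (\<lambda>\<omega>. f (S \<omega>)) \<le> K.binomial_energy d"
    and variance_eq_iff: "variance (\<lambda>\<omega>. f (S \<omega>)) = K.binomial_energy d \<longleftrightarrow>
      (AE \<omega> in M. f (S \<omega>) = m + hoeffding_term M X n f h d \<omega>)"
proof -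
  have var: "variance (\<lambda>\<omega>. f (S \<omega>)) = (\<integral>x. (f x - m)\<^sup>2 \<partial>PiM {1..n} \<mu>)"
    using integral_S[of "\<lambda>x. (f x - m)\<^sup>2"] f_meas_\<mu> by (simp add: m_def)
  have AE_iff: "(AE \<omega> in M. f (S \<omega>) = m + (\<Sum>J\<in>\<J>. H J (S \<omega>))) \<longleftrightarrow>
      (AE x in PiM {1..n} \<mu>. f x = m + (\<Sum>J\<in>\<J>. H J x))" if "\<J> \<subseteq> Pow {1..n}" for \<J>
    using AE_S[OF f_meas_\<mu>, of "\<lambda>x. m + (\<Sum>J\<in>\<J>. H J x)"] sum_H_meas[OF that] by simp
  have "{J. J \<subseteq> {1..n} \<and> d \<le> card J} \<subseteq> Pow {1..n}" by auto
  from f[unfolded sum_hoeffding_terms AE_iff[OF this]]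
  have f': "AE x in PiM {1..n} \<mu>. f x = m + (\<Sum>J | J \<subseteq> {1..n} \<and> d \<le> card J. H J x)" .
  show "variance (\<lambda>\<omega>. f (S \<omega>)) \<le> K.binomial_energy d"
    unfolding var by (rule K.variance_le_binomial_energy[OF assms(1) f'])
  have "{J. J \<subseteq> {1..n} \<and> card J = d} \<subseteq> Pow {1..n}" by auto
  from AE_iff[OF this] show "variance (\<lambda>\<omega>. f (S \<omega>)) = K.binomial_energy d \<longleftrightarrow>
      (AE \<omega> in M. f (S \<omega>) = m + hoeffding_term M X n f h d \<omega>)"
    unfolding var K.variance_eq_binomial_energy_iff[OF assms(1) f'] hoeffding_term_eq by simp
qed

end

theorem theorem1p8:
  fixes M :: "'w measure" and N :: "nat \<Rightarrow> 'a measure" and X :: "nat \<Rightarrow> 'w \<Rightarrow> 'a"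
    and n d :: nat and f :: "(nat \<Rightarrow> 'a) \<Rightarrow> real"
    and h :: "nat set \<Rightarrow> (nat \<Rightarrow> 'a) \<Rightarrow> real"
  assumes "prob_space M"
    and "prob_space.indep_vars M N X {1..n}"
    and "f \<in> borel_measurable (PiM {1..n} N)"
    and "integrable M (\<lambda>\<omega>. (f (subvec X {1..n} \<omega>))\<^sup>2)"
    and "1 \<le> d" and "d \<le> n"
    and "hoeffding_decomposition M N X n f h"
    and "AE \<omega> in M. f (subvec X {1..n} \<omega>) =
           prob_space.expectation M (\<lambda>\<omega>'. f (subvec X {1..n} \<omega>')) +
           (\<Sum>k=d..n. hoeffding_term M X n f h k \<omega>)"
  shows
    "let Var = prob_space.variance M (\<lambda>\<omega>. f (subvec X {1..n} \<omega>));
         \<mu> = law M N X;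
         pure = (AE \<omega> in M. f (subvec X {1..n} \<omega>) =
                   prob_space.expectation M (\<lambda>\<omega>'. f (subvec X {1..n} \<omega>')) +
                   hoeffding_term M X n f h d \<omega>);
         bv = 1 / fact d * mean_sq_norm M X n d (frakv \<mu> f);
         bD = 1 / fact d * mean_sq_norm M X n d (frakD \<mu> f);
         bd = 1 / fact d * mean_sq_norm M X n d (frakd \<mu> f);
         bp = 2 / fact d * mean_sq_norm M X n d (frakd_plus \<mu> f);
         bm = 2 / fact d * mean_sq_norm M X n d (frakd_minus \<mu> f)
     in Var \<le> bv \<and> Var \<le> bD \<and> Var \<le> bd \<and> Var \<le> bp \<and> Var \<le> bm \<and>
        (Var = bv \<longleftrightarrow> pure) \<and> (Var = bD \<longleftrightarrow> pure) \<and> (Var = bd \<longleftrightarrow> pure) \<and>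
        (Var = bp \<longleftrightarrow> pure) \<and> (Var = bm \<longleftrightarrow> pure)"
proof -
  interpret independent_hoeffding M N X n f h
    using assms by (intro independent_hoeffding.intro independent_hoeffding_axioms.intro) auto
  note bounds = variance_le[OF assms(5) assms(8)[folded m_def]]
    variance_eq_iff[OF assms(5) assms(8)[folded m_def]]
  show ?thesis
    \<comment> \<open>The prefactors \<open>1 / d!\<close> and \<open>2 / d!\<close> cancel
      \<open>d!\<close> and \<open>d! / 2\<close>, so all five bounds become
      \<open>K.binomial_energy d\<close>.\<close>
    using bounds assms(5) unfolding Let_def by (simp add: mean_sq_norms m_def)
qed

end
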